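(* Let $R$ be a Gorenstein local domain of dimension one and let $I$ be a nonzero ideal of $R$ which is isomorphic, as an $R$-module, to a trace ideal of $R$. If $I$ is not a free $R$-module, then $I\otimes_R I^*$ has a nonzero torsion submodule.
   Context: For an $R$-module $N$ put $N^*=\operatorname{Hom}_R(N,R)$. The trace ideal of $N$ is $\tau_N(R)=\sum_{\alpha\in N^*}\alpha(N)\subseteq R$; a trace ideal of $R$ is an ideal of the form $\tau_N(R)$ for some $R$-module $N$. *)

theory Defs
  imports "HOL-Algebra.Module" "HOL-Algebra.Ring_Divisibility" "HOL-Library.Extended_Nat"
begin

text \<open>
  Modules are the records of \<^locale>\<open>module\<close>. That record type extends the type of rings, but the
  locale only constrains the carrier, the addition, the zero and the scalar multiplication; the
  ring fields \<open>mult\<close> and \<open>one\<close> of the modules built here carry no information.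
\<close>

section \<open>Homomorphisms, free modules, quotients, tensor products\<close>

definition ring_module :: "('a, 'r) ring_scheme \<Rightarrow> ('a, 'a) module" where
  "ring_module R = \<lparr>carrier = carrier R, monoid.mult = monoid.mult R, one = \<one>\<^bsub>R\<^esub>,
     ring.zero = \<zero>\<^bsub>R\<^esub>, ring.add = ring.add R, smult = monoid.mult R\<rparr>"

text \<open>An ideal, regarded as an \<open>R\<close>-module.\<close>

definition ideal_module :: "('a, 'r) ring_scheme \<Rightarrow> 'a set \<Rightarrow> ('a, 'a) module" where
  "ideal_module R I = (ring_module R)\<lparr>carrier := I\<rparr>"

definition module_homs ::
  "('a, 'r) ring_scheme \<Rightarrow> ('a, 'm, 'x) module_scheme \<Rightarrow> ('a, 'n, 'y) module_scheme \<Rightarrow> ('m \<Rightarrow> 'n) set"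
  where
  "module_homs R M N = {f \<in> carrier M \<rightarrow> carrier N.
     (\<forall>x\<in>carrier M. \<forall>y\<in>carrier M. f (x \<oplus>\<^bsub>M\<^esub> y) = f x \<oplus>\<^bsub>N\<^esub> f y) \<and>
     (\<forall>r\<in>carrier R. \<forall>x\<in>carrier M. f (r \<odot>\<^bsub>M\<^esub> x) = r \<odot>\<^bsub>N\<^esub> f x)}"

definition module_isomorphic ::
  "('a, 'r) ring_scheme \<Rightarrow> ('a, 'm, 'x) module_scheme \<Rightarrow> ('a, 'n, 'y) module_scheme \<Rightarrow> bool" where
  "module_isomorphic R M N \<longleftrightarrow> (\<exists>f\<in>module_homs R M N. bij_betw f (carrier M) (carrier N))"

text \<open>
  The module of homomorphisms from \<open>M\<close> to \<open>N\<close>. Its elements are the homomorphisms that are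
  \<open>undefined\<close> off the carrier of \<open>M\<close>, so that each homomorphism is represented exactly once.
\<close>

definition hom_module ::
  "('a, 'r) ring_scheme \<Rightarrow> ('a, 'm, 'x) module_scheme \<Rightarrow> ('a, 'n, 'y) module_scheme
    \<Rightarrow> ('a, 'm \<Rightarrow> 'n) module" where
  "hom_module R M N = \<lparr>carrier = module_homs R M N \<inter> extensional (carrier M),
     monoid.mult = undefined, one = undefined,
     ring.zero = (\<lambda>x\<in>carrier M. \<zero>\<^bsub>N\<^esub>),
     ring.add = (\<lambda>f g. \<lambda>x\<in>carrier M. f x \<oplus>\<^bsub>N\<^esub> g x),
     smult = (\<lambda>r f. \<lambda>x\<in>carrier M. r \<odot>\<^bsub>N\<^esub> f x)\<rparr>"

definition dual_module ::
  "('a, 'r) ring_scheme \<Rightarrow> ('a, 'm, 'x) module_scheme \<Rightarrow> ('a, 'm \<Rightarrow> 'a) module" where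
  "dual_module R M = hom_module R M (ring_module R)"

text \<open>The free module on a set \<open>S\<close>: the finitely supported functions from \<open>S\<close> to \<open>R\<close>, extended by
  zero off \<open>S\<close>.\<close>

definition free_module :: "('a, 'r) ring_scheme \<Rightarrow> 'i set \<Rightarrow> ('a, 'i \<Rightarrow> 'a) module" where
  "free_module R S = \<lparr>carrier = {c. c ` S \<subseteq> carrier R \<and> (\<forall>x. x \<notin> S \<longrightarrow> c x = \<zero>\<^bsub>R\<^esub>) \<and>
                                   finite {x \<in> S. c x \<noteq> \<zero>\<^bsub>R\<^esub>}},
     monoid.mult = undefined, one = undefined,
     ring.zero = (\<lambda>x. \<zero>\<^bsub>R\<^esub>),
     ring.add = (\<lambda>c d x. c x \<oplus>\<^bsub>R\<^esub> d x),
     smult = (\<lambda>r c x. r \<otimes>\<^bsub>R\<^esub> c x)\<rparr>"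

definition free_generator :: "('a, 'r) ring_scheme \<Rightarrow> 'i \<Rightarrow> 'i \<Rightarrow> 'a" where
  "free_generator R x = (\<lambda>y. if y = x then \<one>\<^bsub>R\<^esub> else \<zero>\<^bsub>R\<^esub>)"

text \<open>\<open>M\<close> is free if it has a basis \<open>B\<close>: every element of \<open>M\<close> is a linear combination of elements
  of \<open>B\<close> for exactly one finitely supported family of coefficients.\<close>

definition is_free_module :: "('a, 'r) ring_scheme \<Rightarrow> ('a, 'm, 'x) module_scheme \<Rightarrow> bool" where
  "is_free_module R M \<longleftrightarrow> (\<exists>B \<subseteq> carrier M.
     bij_betw (\<lambda>c. \<Oplus>\<^bsub>M\<^esub>b\<in>{b \<in> B. c b \<noteq> \<zero>\<^bsub>R\<^esub>}. c b \<odot>\<^bsub>M\<^esub> b)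
       (carrier (free_module R B)) (carrier M))"

definition generated_submodule ::
  "('a, 'r) ring_scheme \<Rightarrow> ('a, 'm, 'x) module_scheme \<Rightarrow> 'm set \<Rightarrow> 'm set" where
  "generated_submodule R M G = \<Inter>{S. submodule S R M \<and> G \<subseteq> S}"

definition quotient_module :: "('a, 'm, 'x) module_scheme \<Rightarrow> 'm set \<Rightarrow> ('a, 'm set) module" where
  "quotient_module M S = \<lparr>carrier = a_rcosets\<^bsub>M\<^esub> S,
     monoid.mult = undefined, one = undefined,
     ring.zero = S,
     ring.add = set_add M,
     smult = (\<lambda>r C. \<Union>x\<in>C. S +>\<^bsub>M\<^esub> (r \<odot>\<^bsub>M\<^esub> x))\<rparr>"

definition tensor_relations ::
  "('a, 'r) ring_scheme \<Rightarrow> ('a, 'm, 'x) module_scheme \<Rightarrow> ('a, 'n, 'y) module_scheme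
    \<Rightarrow> ('m \<times> 'n \<Rightarrow> 'a) set" where
  "tensor_relations R M N =
    (let F = free_module R (carrier M \<times> carrier N); e = (\<lambda>x y. free_generator R (x, y)) in
       {e (x \<oplus>\<^bsub>M\<^esub> x') y \<ominus>\<^bsub>F\<^esub> (e x y \<oplus>\<^bsub>F\<^esub> e x' y) | x x' y.
          x \<in> carrier M \<and> x' \<in> carrier M \<and> y \<in> carrier N} \<union>
       {e x (y \<oplus>\<^bsub>N\<^esub> y') \<ominus>\<^bsub>F\<^esub> (e x y \<oplus>\<^bsub>F\<^esub> e x y') | x y y'.
          x \<in> carrier M \<and> y \<in> carrier N \<and> y' \<in> carrier N} \<union>
       {e (r \<odot>\<^bsub>M\<^esub> x) y \<ominus>\<^bsub>F\<^esub> r \<odot>\<^bsub>F\<^esub> e x y | r x y.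
          r \<in> carrier R \<and> x \<in> carrier M \<and> y \<in> carrier N} \<union>
       {e x (r \<odot>\<^bsub>N\<^esub> y) \<ominus>\<^bsub>F\<^esub> r \<odot>\<^bsub>F\<^esub> e x y | r x y.
          r \<in> carrier R \<and> x \<in> carrier M \<and> y \<in> carrier N})"

definition tensor_module ::
  "('a, 'r) ring_scheme \<Rightarrow> ('a, 'm, 'x) module_scheme \<Rightarrow> ('a, 'n, 'y) module_scheme
    \<Rightarrow> ('a, ('m \<times> 'n \<Rightarrow> 'a) set) module" where
  "tensor_module R M N =
    (let F = free_module R (carrier M \<times> carrier N)
     in quotient_module F (generated_submodule R F (tensor_relations R M N)))"

text \<open>The torsion submodule over a domain \<open>R\<close>, whose regular elements are the nonzero ones.\<close>

definition torsion_submodule ::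
  "('a, 'r) ring_scheme \<Rightarrow> ('a, 'm, 'x) module_scheme \<Rightarrow> 'm set" where
  "torsion_submodule R M =
    {x \<in> carrier M. \<exists>r \<in> carrier R - {\<zero>\<^bsub>R\<^esub>}. r \<odot>\<^bsub>M\<^esub> x = \<zero>\<^bsub>M\<^esub>}"

text \<open>The trace ideal: the sum of the ideals \<open>\<alpha>(N)\<close>, for \<open>\<alpha>\<close> in the dual of \<open>N\<close>, that is, the set of
  all finite sums of elements of these ideals.\<close>

definition trace_ideal :: "('a, 'r) ring_scheme \<Rightarrow> ('a, 'n, 'y) module_scheme \<Rightarrow> 'a set" where
  "trace_ideal R N = {\<Oplus>\<^bsub>R\<^esub>i\<in>{..<k}. \<alpha> i (x i) | (k::nat) \<alpha> x.
     \<forall>i<k. \<alpha> i \<in> carrier (dual_module R N) \<and> x i \<in> carrier N}"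


section \<open>Gorenstein local rings\<close>

text \<open>
  The modules \<open>A\<close>, \<open>B\<close> against which injectivity of \<open>E\<close> is tested have their carriers in the type
  of \<open>E\<close>, since a definition cannot quantify over types. By Baer's criterion the tests with
  \<open>B = R\<close> suffice, so this is injectivity in the usual sense as soon as the type \<^typ>\<open>'e\<close> is at
  least as large as \<^typ>\<open>'a\<close>; it is only used for such types.
\<close>

definition injective_module :: "('a, 'r) ring_scheme \<Rightarrow> ('a, 'e) module \<Rightarrow> bool" where
  "injective_module R E \<longleftrightarrow> module R E \<and>
     (\<forall>(A :: ('a, 'e) module) (B :: ('a, 'e) module) f g.
        module R A \<and> module R B \<and> f \<in> module_homs R A B \<and> inj_on f (carrier A) \<and>
        g \<in> module_homs R A E \<longrightarrow>
        (\<exists>h\<in>module_homs R B E. \<forall>x\<in>carrier A. h (f x) = g x))"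

text \<open>
  A type for the terms of injective resolutions of modules over a ring on \<^typ>\<open>'a\<close> with carrier
  in \<^typ>\<open>'m\<close>. It has cardinality \<open>2 ^ k\<close> with \<open>k\<close> infinite and at least \<open>card R\<close> and
  \<open>card M\<close>. A module \<open>C\<close> of cardinality at most \<open>2 ^ k\<close> embeds into an injective module of
  cardinality at most \<open>(2 ^ k) ^ k = 2 ^ k\<close>, namely the group homomorphisms from \<open>R\<close> into a
  divisible group containing \<open>C\<close>. So every such module has an injective resolution in this
  type, and the injective dimension can be read off from the resolutions in this type.
\<close>

type_synonym ('a, 'm) resolution_type = "('a + 'm + nat) set"

text \<open>\<open>M\<close> has an injective resolution \<open>0 \<rightarrow> M \<rightarrow> E 0 \<rightarrow> \<dots> \<rightarrow> E n \<rightarrow> 0\<close>.\<close>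

definition injective_dimension_le ::
  "('a, 'r) ring_scheme \<Rightarrow> ('a, 'm, 'x) module_scheme \<Rightarrow> nat \<Rightarrow> bool" where
  "injective_dimension_le R M n \<longleftrightarrow>
     (\<exists>(E :: nat \<Rightarrow> ('a, ('a, 'm) resolution_type) module) \<epsilon> d.
        (\<forall>i. injective_module R (E i)) \<and>
        (\<forall>i>n. carrier (E i) = {\<zero>\<^bsub>E i\<^esub>}) \<and>
        \<epsilon> \<in> module_homs R M (E 0) \<and> inj_on \<epsilon> (carrier M) \<and>
        (\<forall>i. d i \<in> module_homs R (E i) (E (Suc i))) \<and>
        \<epsilon> ` carrier M = {x \<in> carrier (E 0). d 0 x = \<zero>\<^bsub>E 1\<^esub>} \<and>
        (\<forall>i. d i ` carrier (E i) =
             {x \<in> carrier (E (Suc i)). d (Suc i) x = \<zero>\<^bsub>E (Suc (Suc i))\<^esub>}))"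

definition local_ring :: "('a, 'r) ring_scheme \<Rightarrow> bool" where
  "local_ring R \<longleftrightarrow> cring R \<and> (\<exists>!\<mm>. maximalideal \<mm> R)"

definition gorenstein_local_ring :: "('a, 'r) ring_scheme \<Rightarrow> bool" where
  "gorenstein_local_ring R \<longleftrightarrow> local_ring R \<and> noetherian_ring R \<and>
     (\<exists>n. injective_dimension_le R (ring_module R) n)"

definition krull_dimension :: "('a, 'r) ring_scheme \<Rightarrow> enat" where
  "krull_dimension R = Sup {enat n | n. \<exists>P :: nat \<Rightarrow> 'a set.
     (\<forall>i\<le>n. primeideal (P i) R) \<and> (\<forall>i<n. P i \<subset> P (Suc i))}"

end

theory Submission
  imports Defs
begin

text \<open>
  Let \<open>f : I \<rightarrow> R\<close> be an injective homomorphism onto the trace ideal \<open>J\<close>. Every homomorphism \<open>I \<rightarrow> R\<close>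
  has its image in \<open>J\<close>, so for \<open>\<phi> \<in> I\<^sup>*\<close> and \<open>i \<in> I\<close> there is \<open>z \<in> I\<close> with \<open>f z = \<phi> i\<close>, and
  \<open>i \<otimes> \<phi> - z \<otimes> f\<close> is a torsion element because \<open>I\<^sup>*\<close> has rank one.
  As \<open>I\<close> is not free, \<open>J\<close> is a proper ideal, and a socle element of \<open>R / x R\<close> shows that \<open>f\<close> does
  not generate \<open>I\<^sup>*\<close>: some \<open>y / x \<notin> R\<close> multiplies \<open>\<mm>\<close>, hence \<open>J\<close>, into \<open>R\<close>. So there are nonzero
  linear maps \<open>\<beta>\<close> on \<open>I\<close> and \<open>\<gamma>\<close> on \<open>I\<^sup>*\<close> into the residue field with \<open>\<gamma> f = 0\<close>, and the bilinear map
  \<open>\<beta> \<cdot> \<gamma>\<close> detects the torsion element for suitable \<open>i\<close> and \<open>\<phi>\<close>.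
\<close>

section \<open>Noetherian local rings\<close>

text \<open>By the ascending chain condition the union of a nonempty chain of ideals is a member of
  the chain, so Zorn's lemma applies to any nonempty family of ideals. It serves for proper ideals,
  for ideals between two given ones and for annihilators.\<close>

lemma (in noetherian_ring) obtain_maximal_ideal_with:
  assumes ideals: "\<And>K. P K \<Longrightarrow> ideal K R" and PJ: "P J"
  obtains M where "P M" and "\<And>K. P K \<Longrightarrow> M \<subseteq> K \<Longrightarrow> K = M"
proof -
  have "\<Union>C \<in> Collect P" if C: "C \<noteq> {}" "subset.chain (Collect P) C" for C
  proof -
    have "subset.chain {I. ideal I R} C"
      using C(2) ideals by (simp add: subset_chain_def subset_iff)
    then have "\<Union>C \<in> C"
      using C(1) by (rule ideal_chain_is_trivial[rotated])
    then show "\<Union>C \<in> Collect P"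
      using C(2) by (auto simp only: subset_chain_def subset_iff)
  qed
  moreover have "Collect P \<noteq> {}"
    using PJ by (simp only: Collect_empty_eq not_all not_not) (rule exI)
  ultimately have "\<exists>M\<in>Collect P. \<forall>K\<in>Collect P. M \<subseteq> K \<longrightarrow> K = M"
    by (intro subset_Zorn_nonempty)
  then obtain M where "M \<in> Collect P" "\<forall>K\<in>Collect P. M \<subseteq> K \<longrightarrow> K = M"
    by (rule bexE)
  then show ?thesis using that by simp
qed

lemma (in ideal) ideal_minus_closed: "x \<in> I \<Longrightarrow> y \<in> I \<Longrightarrow> x \<ominus> y \<in> I"
  by (simp add: a_minus_def)

text \<open>Maps into the residue field are represented by maps into \<open>R\<close> that are linear modulo \<open>\<mm>\<close>.\<close>

definition linear_modulo :: "('a, 'r) ring_scheme \<Rightarrow> 'a set \<Rightarrow> 'a set \<Rightarrow> ('a \<Rightarrow> 'a) \<Rightarrow> bool" where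
  "linear_modulo R \<mm> A \<gamma> \<longleftrightarrow> \<gamma> \<in> A \<rightarrow> carrier R \<and>
     (\<forall>u\<in>A. \<forall>v\<in>A. \<gamma> (u \<oplus>\<^bsub>R\<^esub> v) \<ominus>\<^bsub>R\<^esub> (\<gamma> u \<oplus>\<^bsub>R\<^esub> \<gamma> v) \<in> \<mm>) \<and>
     (\<forall>r\<in>carrier R. \<forall>u\<in>A. \<gamma> (r \<otimes>\<^bsub>R\<^esub> u) \<ominus>\<^bsub>R\<^esub> r \<otimes>\<^bsub>R\<^esub> \<gamma> u \<in> \<mm>)"

locale noetherian_local_ring = cring R + noetherian_ring R for R (structure) +
  fixes \<mm>
  assumes maximal: "maximalideal \<mm> R"
    and maximal_unique: "maximalideal J R \<Longrightarrow> J = \<mm>"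
begin

text \<open>An ideal that is maximal among the proper ideals containing \<open>J\<close> is a
  maximal ideal of \<open>R\<close>, and \<open>\<mm>\<close> is the only one.\<close>

lemma proper_ideal_subset:
  assumes "ideal J R" and "J \<noteq> carrier R"
  shows "J \<subseteq> \<mm>"
proof -
  obtain K where K: "ideal K R \<and> J \<subseteq> K \<and> K \<noteq> carrier R"
    and max: "\<And>X. ideal X R \<and> J \<subseteq> X \<and> X \<noteq> carrier R \<Longrightarrow> K \<subseteq> X \<Longrightarrow> X = K"
    by (rule obtain_maximal_ideal_with[of "\<lambda>K. ideal K R \<and> J \<subseteq> K \<and> K \<noteq> carrier R" J])
      (use assms in simp_all)
  have "maximalideal K R"
  proof (rule maximalidealI)
    show "ideal K R" and "carrier R \<noteq> K"
      using K by auto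
    fix X assume X: "ideal X R" "K \<subseteq> X"
    show "X = K \<or> X = carrier R"
    proof (rule disjCI)
      assume "X \<noteq> carrier R"
      then show "X = K" using K X by (intro max) auto
    qed
  qed
  then have "K = \<mm>"
    by (rule maximal_unique)
  then show ?thesis
    using K by simp
qed

lemma one_notin_maximal: "\<one> \<notin> \<mm>"
proof
  assume "\<one> \<in> \<mm>"
  then have "\<mm> = carrier R"
    by (rule ideal.one_imp_carrier[OF maximalideal.axioms(1)[OF maximal]])
  then show False
    using maximalideal.I_notcarr[OF maximal] by simp
qed

text \<open>The principal ideal of \<open>r\<close> is not contained in \<open>\<mm>\<close>, so it
  cannot be proper and contains \<open>\<one>\<close>.\<close>

lemma notin_maximal_obtain_inverse:
  assumes "r \<in> carrier R" and "r \<notin> \<mm>"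
  obtains s where "s \<in> carrier R" and "s \<otimes> r = \<one>"
proof -
  have "PIdl r = carrier R"
    using proper_ideal_subset[OF cgenideal_ideal[OF assms(1)]] cgenideal_self[OF assms(1)] assms(2)
    by (cases "PIdl r = carrier R") auto
  then have "\<one> \<in> PIdl r"
    by simp
  then obtain s where "s \<in> carrier R" "\<one> = s \<otimes> r"
    by (auto simp only: cgenideal_def)
  then show ?thesis
    by (intro that) simp_all
qed

text \<open>If \<open>D\<close> is maximal among the ideals with \<open>B \<subseteq> D \<subset> A\<close>, then \<open>A / D\<close> is generated by one element \<open>x\<close>,
  and \<open>\<gamma> u\<close> is the coefficient of \<open>u\<close> with respect to \<open>x\<close>, which is well defined modulo \<open>\<mm>\<close>.\<close>

lemma exists_linear_modulo:
  assumes A: "ideal A R" and B: "ideal B R" and "B \<subset> A"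
  shows "\<exists>\<gamma>. linear_modulo R \<mm> A \<gamma> \<and> (\<forall>b\<in>B. \<gamma> b \<in> \<mm>) \<and> (\<exists>x\<in>A. \<gamma> x \<notin> \<mm>)"
proof -
  obtain D where D: "ideal D R \<and> B \<subseteq> D \<and> D \<subset> A"
    and max: "\<And>X. ideal X R \<and> B \<subseteq> X \<and> X \<subset> A \<Longrightarrow> D \<subseteq> X \<Longrightarrow> X = D"
    by (rule obtain_maximal_ideal_with[of "\<lambda>D. ideal D R \<and> B \<subseteq> D \<and> D \<subset> A" B])
      (use assms in simp_all)
  interpret A: ideal A R by fact
  interpret D: ideal D R using D by blast
  interpret m: ideal \<mm> R using maximal by (rule maximalideal.axioms)
  obtain x where x: "x \<in> A" "x \<notin> D"
    using D by blast
  have xR: "x \<in> carrier R" using x A.a_subset by blast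
  have sub: "D <+>\<^bsub>R\<^esub> PIdl x \<subseteq> A"
  proof
    fix u assume "u \<in> D <+>\<^bsub>R\<^esub> PIdl x"
    then obtain d r where "d \<in> D" "r \<in> carrier R" "u = d \<oplus> r \<otimes> x"
      unfolding set_add_def' cgenideal_def by blast
    then show "u \<in> A"
      using D x A.I_l_closed A.a_closed by blast
  qed
  have "D \<subseteq> D <+>\<^bsub>R\<^esub> PIdl x" "x \<in> D <+>\<^bsub>R\<^esub> PIdl x"
  proof -
    have z: "\<zero> \<in> PIdl x"
      using additive_subgroup.zero_closed[OF ideal.axioms(1)[OF cgenideal_ideal[OF xR]]] .
    show "D \<subseteq> D <+>\<^bsub>R\<^esub> PIdl x"
    proof
      fix d assume d: "d \<in> D"
      then have "d = d \<oplus> \<zero>" using D.a_subset by auto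
      then show "d \<in> D <+>\<^bsub>R\<^esub> PIdl x" using d z unfolding set_add_def' by blast
    qed
    have "x = \<zero> \<oplus> x" using xR by simp
    then show "x \<in> D <+>\<^bsub>R\<^esub> PIdl x"
      using D.zero_closed cgenideal_self[OF xR] unfolding set_add_def' by blast
  qed
  \<comment> \<open>The sum lies between \<open>B\<close> and \<open>A\<close> and is strictly
    larger than \<open>D\<close>. By the maximality of \<open>D\<close> it cannot be strictly
    smaller than \<open>A\<close>.\<close>
  then have gen: "D <+>\<^bsub>R\<^esub> PIdl x = A"
    using max[of "D <+>\<^bsub>R\<^esub> PIdl x"] add_ideals[OF D.ideal_axioms cgenideal_ideal[OF xR]] sub D x by blast
  have ex: "\<exists>r. r \<in> carrier R \<and> u \<ominus> r \<otimes> x \<in> D" if "u \<in> A" for u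
  proof -
    from that gen obtain d r where "d \<in> D" "r \<in> carrier R" "u = d \<oplus> r \<otimes> x"
      unfolding set_add_def' cgenideal_def by blast
    moreover from this have "u \<ominus> r \<otimes> x = d"
      using xR D.a_subset by (auto simp: a_minus_def a_assoc r_neg)
    ultimately show ?thesis by auto
  qed
  \<comment> \<open>The coefficient of \<open>u\<close> is unique only modulo \<open>\<mm>\<close>,
    so an arbitrary choice yields a map that is linear only modulo \<open>\<mm>\<close>.\<close>
  define \<gamma> where "\<gamma> u = (SOME r. r \<in> carrier R \<and> u \<ominus> r \<otimes> x \<in> D)" for u
  have \<gamma>: "\<gamma> u \<in> carrier R" "u \<ominus> \<gamma> u \<otimes> x \<in> D" if "u \<in> A" for u
    using someI_ex[OF ex[OF that]] unfolding \<gamma>_def by auto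
  \<comment> \<open>A coefficient outside \<open>\<mm>\<close> is invertible and would put
    \<open>x\<close> into \<open>D\<close>. Below, membership of a coefficient in
    \<open>\<mm>\<close> is tested by multiplying it with \<open>x\<close>.\<close>
  have key: "r \<in> \<mm>" if r: "r \<in> carrier R" "r \<otimes> x \<in> D" for r
  proof (rule ccontr)
    assume "r \<notin> \<mm>"
    then obtain s where s: "s \<in> carrier R" "s \<otimes> r = \<one>"
      using notin_maximal_obtain_inverse r by blast
    have "s \<otimes> (r \<otimes> x) \<in> D"
      using D.I_l_closed r s by blast
    then show False
      using r s xR x by (simp add: m_assoc[symmetric])
  qed
  have AR: "u \<in> carrier R" if "u \<in> A" for u
    using that A.a_subset by blast
  have add: "\<gamma> (u \<oplus> v) \<ominus> (\<gamma> u \<oplus> \<gamma> v) \<in> \<mm>" if uv: "u \<in> A" "v \<in> A" for u v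
  proof (rule key)
    have w: "u \<oplus> v \<in> A" using uv by simp
    show "\<gamma> (u \<oplus> v) \<ominus> (\<gamma> u \<oplus> \<gamma> v) \<in> carrier R"
      using \<gamma> uv w by simp
    have "(\<gamma> (u \<oplus> v) \<ominus> (\<gamma> u \<oplus> \<gamma> v)) \<otimes> x
        = (u \<ominus> \<gamma> u \<otimes> x) \<oplus> (v \<ominus> \<gamma> v \<otimes> x) \<ominus> (u \<oplus> v \<ominus> \<gamma> (u \<oplus> v) \<otimes> x)"
      using \<gamma>(1)[OF uv(1)] \<gamma>(1)[OF uv(2)] \<gamma>(1)[OF w] xR AR uv by algebra
    also have "\<dots> \<in> D"
      by (rule D.ideal_minus_closed[OF D.a_closed[OF \<gamma>(2)[OF uv(1)] \<gamma>(2)[OF uv(2)]] \<gamma>(2)[OF w]])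
    finally show "(\<gamma> (u \<oplus> v) \<ominus> (\<gamma> u \<oplus> \<gamma> v)) \<otimes> x \<in> D" .
  qed
  have mult: "\<gamma> (r \<otimes> u) \<ominus> r \<otimes> \<gamma> u \<in> \<mm>" if ru: "r \<in> carrier R" "u \<in> A" for r u
  proof (rule key)
    have w: "r \<otimes> u \<in> A" using ru A.I_l_closed by simp
    show "\<gamma> (r \<otimes> u) \<ominus> r \<otimes> \<gamma> u \<in> carrier R"
      using \<gamma> ru w by simp
    have "(\<gamma> (r \<otimes> u) \<ominus> r \<otimes> \<gamma> u) \<otimes> x = r \<otimes> (u \<ominus> \<gamma> u \<otimes> x) \<ominus> (r \<otimes> u \<ominus> \<gamma> (r \<otimes> u) \<otimes> x)"
      using \<gamma>(1)[OF ru(2)] \<gamma>(1)[OF w] xR AR ru by algebra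
    also have "\<dots> \<in> D"
      by (rule D.ideal_minus_closed[OF D.I_l_closed[OF \<gamma>(2)[OF ru(2)] ru(1)] \<gamma>(2)[OF w]])
    finally show "(\<gamma> (r \<otimes> u) \<ominus> r \<otimes> \<gamma> u) \<otimes> x \<in> D" .
  qed
  have B': "\<gamma> b \<in> \<mm>" if b: "b \<in> B" for b
  proof (rule key)
    have bA: "b \<in> A" "b \<in> D" using b D by auto
    show "\<gamma> b \<in> carrier R" using \<gamma> bA by simp
    have "\<gamma> b \<otimes> x = b \<ominus> (b \<ominus> \<gamma> b \<otimes> x)"
      using \<gamma>(1)[OF bA(1)] AR[OF bA(1)] xR by algebra
    also have "\<dots> \<in> D" by (rule D.ideal_minus_closed[OF bA(2) \<gamma>(2)[OF bA(1)]])
    finally show "\<gamma> b \<otimes> x \<in> D" .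
  qed
  have "\<gamma> x \<notin> \<mm>"
  proof
    assume gx: "\<gamma> x \<in> \<mm>"
    \<comment> \<open>Both \<open>\<one>\<close> and \<open>\<gamma> x\<close> are coefficients of
      \<open>x\<close>, so they agree modulo \<open>\<mm>\<close>, and \<open>\<gamma> x\<close> in
      \<open>\<mm>\<close> would force \<open>\<one>\<close> into \<open>\<mm>\<close>.\<close>
    have "(\<one> \<ominus> \<gamma> x) \<otimes> x \<in> D"
      using \<gamma>[OF x(1)] xR by (simp add: a_minus_def l_distr l_minus)
    then have "\<one> \<ominus> \<gamma> x \<in> \<mm>"
      using key \<gamma>(1)[OF x(1)] by simp
    then have "(\<one> \<ominus> \<gamma> x) \<oplus> \<gamma> x \<in> \<mm>"
      using gx by simp
    then show False
      using one_notin_maximal \<gamma>(1)[OF x(1)] by (simp add: a_minus_def a_assoc l_neg)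
  qed
  moreover have "linear_modulo R \<mm> A \<gamma>"
    unfolding linear_modulo_def by (intro conjI ballI funcsetI \<gamma>(1) add mult)
  ultimately show ?thesis
    using B' x(1) by (intro exI[of _ \<gamma>] conjI) auto
qed

end

section \<open>Associated primes and the socle in dimension one\<close>

lemma (in cring) noetherian_exists_prime_colon:
  assumes "noetherian_ring R" and x: "x \<in> carrier R" and "PIdl x \<noteq> carrier R"
  shows "\<exists>y\<in>carrier R. y \<notin> PIdl x \<and> primeideal {t \<in> carrier R. y \<otimes> t \<in> PIdl x} R"
proof -
  interpret noetherian_ring R by fact
  interpret X: ideal "PIdl x" R using cgenideal_ideal x .
  let ?P = "\<lambda>y. {t \<in> carrier R. y \<otimes> t \<in> PIdl x}"
  have idl: "ideal (?P y) R" if "y \<in> carrier R" for y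
    using X.helper_max_prime[OF cring_axioms that] .
  have ne: "\<one> \<notin> PIdl x"
    using X.one_imp_carrier assms(3) by blast
  \<comment> \<open>A maximal member among the annihilators of nonzero elements of
    \<open>R / (x)\<close> is an associated prime. The family contains the annihilator of
    \<open>\<one>\<close>, which is nonzero in \<open>R / (x)\<close> because \<open>PIdl x\<close>
    is proper.\<close>
  obtain P where "\<exists>y\<in>carrier R. y \<notin> PIdl x \<and> P = ?P y"
    and max: "\<And>Q. \<exists>y\<in>carrier R. y \<notin> PIdl x \<and> Q = ?P y \<Longrightarrow> P \<subseteq> Q \<Longrightarrow> Q = P"
    by (rule obtain_maximal_ideal_with[of "\<lambda>Q. \<exists>y\<in>carrier R. y \<notin> PIdl x \<and> Q = ?P y" "?P \<one>"])
      (use idl ne in blast)+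
  then obtain y where y: "y \<in> carrier R" "y \<notin> PIdl x" "P = ?P y" by blast
  have "primeideal (?P y) R"
  proof (rule primeidealI[OF idl cring_axioms])
    show "y \<in> carrier R" by fact
    show "carrier R \<noteq> ?P y"
    proof
      assume "carrier R = ?P y"
      then have "y \<otimes> \<one> \<in> PIdl x" using one_closed by blast
      then show False using y by simp
    qed
    fix a b assume ab: "a \<in> carrier R" "b \<in> carrier R" "a \<otimes> b \<in> ?P y"
    show "a \<in> ?P y \<or> b \<in> ?P y"
    proof (rule disjCI)
      assume "b \<notin> ?P y"
      then have yb: "y \<otimes> b \<in> carrier R" "y \<otimes> b \<notin> PIdl x" using y ab by auto
      \<comment> \<open>Passing from \<open>y\<close> to the multiple \<open>y \<otimes> b\<close>,
        which is still nonzero modulo \<open>x\<close>, can only enlarge the annihilator, so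
        maximality makes the two equal; and \<open>a\<close> annihilates
        \<open>y \<otimes> b\<close>.\<close>
      have "?P y \<subseteq> ?P (y \<otimes> b)"
      proof
        fix t assume "t \<in> ?P y"
        then have t: "t \<in> carrier R" "b \<otimes> (y \<otimes> t) \<in> PIdl x" using X.I_l_closed ab by auto
        moreover have "b \<otimes> (y \<otimes> t) = y \<otimes> b \<otimes> t"
          using t(1) ab y by algebra
        ultimately show "t \<in> ?P (y \<otimes> b)" by simp
      qed
      then have "?P (y \<otimes> b) = ?P y"
        using max[of "?P (y \<otimes> b)"] yb y by blast
      moreover have "a \<in> ?P (y \<otimes> b)"
        using ab y by (simp add: m_assoc m_comm[of b a])
      ultimately show "a \<in> ?P y" by blast
    qed
  qed
  then show ?thesis using y by blast
qed

text \<open>A supremum equal to 1 rules out that every chain of primes has length 0, and it also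
  rules out a chain of length 2.\<close>

lemma krull_dimension_oneD:
  assumes "krull_dimension R = 1"
  shows "\<exists>P Q. primeideal P R \<and> primeideal Q R \<and> P \<subset> Q"
    and "\<not> (primeideal P R \<and> primeideal Q R \<and> primeideal T R \<and> P \<subset> Q \<and> Q \<subset> T)"
proof -
  let ?S = "{enat n | n. \<exists>P :: nat \<Rightarrow> 'a set.
     (\<forall>i\<le>n. primeideal (P i) R) \<and> (\<forall>i<n. P i \<subset> P (Suc i))}"
  have S: "Sup ?S = 1" using assms unfolding krull_dimension_def .
  have "\<exists>n\<in>?S. n \<noteq> 0"
  proof (rule ccontr)
    assume "\<not> ?thesis"
    then have "k = 0" if "k \<in> ?S" for k
      using that by blast
    then have "Sup ?S \<le> 0" by (intro Sup_least) simp
    then show False using S by simp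
  qed
  then obtain n C where n: "enat n \<noteq> 0"
    and C: "\<forall>i\<le>n. primeideal (C i) R" "\<forall>i<n. C i \<subset> C (Suc i)" by blast
  then have "0 < n" by (cases n) (auto simp: zero_enat_def)
  then show "\<exists>P Q. primeideal P R \<and> primeideal Q R \<and> P \<subset> Q"
    using C(1)[rule_format, of 0] C(1)[rule_format, of 1] C(2)[rule_format, of 0] by auto
  show "\<not> (primeideal P R \<and> primeideal Q R \<and> primeideal T R \<and> P \<subset> Q \<and> Q \<subset> T)"
  proof
    assume a: "primeideal P R \<and> primeideal Q R \<and> primeideal T R \<and> P \<subset> Q \<and> Q \<subset> T"
    \<comment> \<open>Three primes make a chain of length 2; the values beyond index 2 are not
      constrained.\<close>
    define C where "C i = (if i = 0 then P else if i = 1 then Q else T)" for i :: nat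
    have "(\<forall>i\<le>2. primeideal (C i) R) \<and> (\<forall>i<2. C i \<subset> C (Suc i))"
      using a by (auto simp: C_def less_2_cases_iff)
    then have "enat 2 \<in> ?S" by (intro CollectI exI[of _ 2] conjI refl exI[of _ C]) simp_all
    then have "enat 2 \<le> 1" using Sup_upper[of "enat 2" ?S] S by simp
    then show False by (simp add: one_enat_def)
  qed
qed

text \<open>An associated prime of \<open>R / (x)\<close>, for a nonzero nonunit \<open>x\<close>,
  contains \<open>x\<close> and hence equals \<open>\<mm>\<close> in dimension one. Then
  \<open>y\<close> is a nonzero socle element of \<open>R / (x)\<close>: the fraction
  \<open>y / x\<close> lies outside \<open>R\<close> but multiplies \<open>\<mm>\<close> into
  \<open>R\<close>.\<close>

lemma (in noetherian_local_ring) dim_one_domain_socle: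
  assumes "domain R" and "krull_dimension R = 1"
  shows "\<exists>x\<in>carrier R. \<exists>y\<in>carrier R. x \<noteq> \<zero> \<and> y \<notin> PIdl x \<and> (\<forall>t\<in>\<mm>. y \<otimes> t \<in> PIdl x)"
proof -
  interpret domain R by fact
  obtain P Q where PQ: "primeideal P R" "primeideal Q R" "P \<subset> Q"
    using krull_dimension_oneD(1)[OF assms(2)] by blast
  interpret P: primeideal P R by fact
  interpret Q: primeideal Q R by fact
  \<comment> \<open>An element outside \<open>P\<close> is nonzero, and an element of the proper
    ideal \<open>Q\<close> is a nonunit.\<close>
  obtain x where x: "x \<in> Q" "x \<notin> P" using PQ by blast
  have x0: "x \<noteq> \<zero>" and xR: "x \<in> carrier R" using x P.zero_closed Q.a_subset by auto
  have "PIdl x \<noteq> carrier R"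
    using cgenideal_minimal[OF Q.ideal_axioms x(1)] Q.I_notcarr Q.a_subset by blast
  then obtain y where y: "y \<in> carrier R" "y \<notin> PIdl x"
    and prime: "primeideal {t \<in> carrier R. y \<otimes> t \<in> PIdl x} R"
    using noetherian_exists_prime_colon[OF noetherian_ring_axioms xR] by blast
  define T where "T = {t \<in> carrier R. y \<otimes> t \<in> PIdl x}"
  interpret T: primeideal T R using prime unfolding T_def .
  have "y \<otimes> x \<in> PIdl x"
    using y(1) unfolding cgenideal_def by blast
  then have "x \<in> T" using xR unfolding T_def by simp
  then have "{\<zero>} \<subset> T" using x0 T.zero_closed by blast
  moreover have "T \<subseteq> \<mm>" using proper_ideal_subset[OF T.ideal_axioms] T.I_notcarr by simp
  moreover have "primeideal \<mm> R" by (rule maximalideal_prime[OF maximal])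
  \<comment> \<open>Otherwise \<open>{\<zero>}\<close>, \<open>T\<close> and \<open>\<mm>\<close>
    would form a chain of three primes.\<close>
  ultimately have "T = \<mm>"
    using krull_dimension_oneD(2)[OF assms(2), of "{\<zero>}" T \<mm>] zeroprimeideal T.primeideal by blast
  have "y \<otimes> t \<in> PIdl x" if "t \<in> \<mm>" for t
  proof -
    have "t \<in> T" using that \<open>T = \<mm>\<close> by simp
    then show ?thesis unfolding T_def by simp
  qed
  then show ?thesis
    using x0 y by (intro bexI[OF _ xR] bexI[OF _ y(1)]) simp
qed

section \<open>Modules and tensor products\<close>

lemma ring_module_simps [simp]:
  "carrier (ring_module R) = carrier R"
  "ring.add (ring_module R) = ring.add R"
  "ring.zero (ring_module R) = \<zero>\<^bsub>R\<^esub>"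
  "smult (ring_module R) = monoid.mult R"
  by (simp_all add: ring_module_def)

lemma ideal_module_simps [simp]:
  "carrier (ideal_module R I) = I"
  "ring.add (ideal_module R I) = ring.add R"
  "ring.zero (ideal_module R I) = \<zero>\<^bsub>R\<^esub>"
  "smult (ideal_module R I) = monoid.mult R"
  by (simp_all add: ideal_module_def ring_module_def)

lemma (in cring) ideal_module_is_module:
  assumes "ideal I R"
  shows "module R (ideal_module R I)"
proof -
  interpret I: ideal I R by fact
  have IR: "x \<in> carrier R" if "x \<in> I" for x
    using that I.a_subset by auto
  show ?thesis
  proof (rule moduleI[OF cring_axioms])
    show "abelian_group (ideal_module R I)"
    proof (rule abelian_groupI, simp_all)
      fix x assume x: "x \<in> I"
      then have "\<ominus> x \<in> I" by simp
      moreover have "\<ominus> x \<oplus> x = \<zero>" using IR[OF x] by (simp add: l_neg)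
      ultimately show "\<exists>y\<in>I. y \<oplus> x = \<zero>" by (rule bexI[rotated])
    qed (simp_all add: IR a_ac)
  qed (simp_all add: IR l_distr r_distr m_assoc I.I_l_closed)
qed

lemma (in cring) ring_module_is_module: "module R (ring_module R)"
  using ideal_module_is_module[OF oneideal] by (simp add: ideal_module_def ring_module_def)

lemma hom_module_simps [simp]:
  "carrier (hom_module R M N) = module_homs R M N \<inter> extensional (carrier M)"
  "ring.add (hom_module R M N) = (\<lambda>f g. \<lambda>x\<in>carrier M. f x \<oplus>\<^bsub>N\<^esub> g x)"
  "ring.zero (hom_module R M N) = (\<lambda>x\<in>carrier M. \<zero>\<^bsub>N\<^esub>)"
  "smult (hom_module R M N) = (\<lambda>r f. \<lambda>x\<in>carrier M. r \<odot>\<^bsub>N\<^esub> f x)"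
  by (simp_all add: hom_module_def)

lemma module_homsD:
  assumes "f \<in> module_homs R M N"
  shows "x \<in> carrier M \<Longrightarrow> f x \<in> carrier N"
    and "x \<in> carrier M \<Longrightarrow> y \<in> carrier M \<Longrightarrow> f (x \<oplus>\<^bsub>M\<^esub> y) = f x \<oplus>\<^bsub>N\<^esub> f y"
    and "r \<in> carrier R \<Longrightarrow> x \<in> carrier M \<Longrightarrow> f (r \<odot>\<^bsub>M\<^esub> x) = r \<odot>\<^bsub>N\<^esub> f x"
  using assms by (auto simp: module_homs_def)

lemma module_homsI:
  assumes "\<And>x. x \<in> carrier M \<Longrightarrow> f x \<in> carrier N"
    and "\<And>x y. x \<in> carrier M \<Longrightarrow> y \<in> carrier M \<Longrightarrow> f (x \<oplus>\<^bsub>M\<^esub> y) = f x \<oplus>\<^bsub>N\<^esub> f y"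
    and "\<And>r x. r \<in> carrier R \<Longrightarrow> x \<in> carrier M \<Longrightarrow> f (r \<odot>\<^bsub>M\<^esub> x) = r \<odot>\<^bsub>N\<^esub> f x"
  shows "f \<in> module_homs R M N"
  using assms by (simp add: module_homs_def)

lemma module_homs_compose:
  assumes f: "f \<in> module_homs R L M" and g: "g \<in> module_homs R M N"
  shows "(\<lambda>x. g (f x)) \<in> module_homs R L N"
  by (rule module_homsI) (simp_all add: module_homsD[OF f] module_homsD[OF g])

lemma hom_module_is_module:
  assumes "module R M" and "module R N"
  shows "module R (hom_module R M N)"
proof -
  interpret M: module R M by fact
  interpret N: module R N by fact
  have add: "(\<lambda>x\<in>carrier M. f x \<oplus>\<^bsub>N\<^esub> g x) \<in> module_homs R M N"
    if f: "f \<in> module_homs R M N" and g: "g \<in> module_homs R M N" for f g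
    by (rule module_homsI) (simp_all add: module_homsD[OF f] module_homsD[OF g] N.a_ac N.smult_r_distr)
  have smult: "(\<lambda>x\<in>carrier M. r \<odot>\<^bsub>N\<^esub> f x) \<in> module_homs R M N"
    if r: "r \<in> carrier R" and f: "f \<in> module_homs R M N" for r f
  proof (rule module_homsI)
    fix s x assume sx: "s \<in> carrier R" "x \<in> carrier M"
    have "r \<odot>\<^bsub>N\<^esub> (s \<odot>\<^bsub>N\<^esub> f x) = s \<odot>\<^bsub>N\<^esub> (r \<odot>\<^bsub>N\<^esub> f x)"
      using r sx by (simp add: module_homsD[OF f] N.smult_assoc1[symmetric] M.m_comm)
    then show "(\<lambda>x\<in>carrier M. r \<odot>\<^bsub>N\<^esub> f x) (s \<odot>\<^bsub>M\<^esub> x) = s \<odot>\<^bsub>N\<^esub> (\<lambda>x\<in>carrier M. r \<odot>\<^bsub>N\<^esub> f x) x"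
      using r sx by (simp add: module_homsD[OF f])
  qed (use r in \<open>simp_all add: module_homsD[OF f] N.smult_r_distr\<close>)
  have zero: "(\<lambda>x\<in>carrier M. \<zero>\<^bsub>N\<^esub>) \<in> module_homs R M N"
    by (rule module_homsI) simp_all
  show ?thesis
  proof (rule moduleI[OF M.R.is_cring])
    show "abelian_group (hom_module R M N)"
    proof (rule abelian_groupI)
      fix f assume f: "f \<in> carrier (hom_module R M N)"
      then have fh: "f \<in> module_homs R M N" and fe: "f \<in> extensional (carrier M)" by simp_all
      \<comment> \<open>The negative of \<open>f\<close>, written as a scalar multiple so that
        \<open>smult\<close> shows it to be a homomorphism.\<close>
      let ?g = "\<lambda>x\<in>carrier M. \<ominus>\<^bsub>R\<^esub> \<one>\<^bsub>R\<^esub> \<odot>\<^bsub>N\<^esub> f x"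
      have "?g \<in> carrier (hom_module R M N)"
        using smult[OF _ fh] by simp
      moreover have "?g \<oplus>\<^bsub>hom_module R M N\<^esub> f = \<zero>\<^bsub>hom_module R M N\<^esub>"
        by (auto simp: fun_eq_iff restrict_def module_homsD[OF fh] N.smult_l_minus N.l_neg)
      ultimately show "\<exists>g\<in>carrier (hom_module R M N). g \<oplus>\<^bsub>hom_module R M N\<^esub> f = \<zero>\<^bsub>hom_module R M N\<^esub>"
        by (intro bexI[of _ ?g])
      show "\<zero>\<^bsub>hom_module R M N\<^esub> \<oplus>\<^bsub>hom_module R M N\<^esub> f = f"
        by (rule extensionalityI[OF _ fe]) (simp_all add: module_homsD[OF fh])
    next
      fix f g assume fg: "f \<in> carrier (hom_module R M N)" "g \<in> carrier (hom_module R M N)"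
      then show "f \<oplus>\<^bsub>hom_module R M N\<^esub> g \<in> carrier (hom_module R M N)"
        by (simp add: add)
      show "f \<oplus>\<^bsub>hom_module R M N\<^esub> g = g \<oplus>\<^bsub>hom_module R M N\<^esub> f"
        using fg by (auto simp: fun_eq_iff restrict_def module_homsD N.a_comm)
    next
      fix f g h assume "f \<in> carrier (hom_module R M N)" "g \<in> carrier (hom_module R M N)"
        "h \<in> carrier (hom_module R M N)"
      then show "f \<oplus>\<^bsub>hom_module R M N\<^esub> g \<oplus>\<^bsub>hom_module R M N\<^esub> h
          = f \<oplus>\<^bsub>hom_module R M N\<^esub> (g \<oplus>\<^bsub>hom_module R M N\<^esub> h)"
        by (auto simp: fun_eq_iff restrict_def module_homsD N.a_assoc)
    qed (simp add: zero)
  next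
    fix f assume "f \<in> carrier (hom_module R M N)"
    then have fh: "f \<in> module_homs R M N" and fe: "f \<in> extensional (carrier M)" by simp_all
    show "\<one>\<^bsub>R\<^esub> \<odot>\<^bsub>hom_module R M N\<^esub> f = f"
      by (rule extensionalityI[OF _ fe]) (simp_all add: module_homsD[OF fh])
  next
    fix r f assume "r \<in> carrier R" "f \<in> carrier (hom_module R M N)"
    then show "r \<odot>\<^bsub>hom_module R M N\<^esub> f \<in> carrier (hom_module R M N)"
      by (simp add: smult)
  qed (auto simp: fun_eq_iff restrict_def module_homsD N.smult_l_distr N.smult_r_distr N.smult_assoc1)
qed

section \<open>Free modules and their linear functionals\<close>

lemma free_module_simps:
  "carrier (free_module R S) = {c. c ` S \<subseteq> carrier R \<and> (\<forall>x. x \<notin> S \<longrightarrow> c x = \<zero>\<^bsub>R\<^esub>) \<and>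
      finite {x \<in> S. c x \<noteq> \<zero>\<^bsub>R\<^esub>}}"
  "ring.add (free_module R S) = (\<lambda>c d x. c x \<oplus>\<^bsub>R\<^esub> d x)"
  "ring.zero (free_module R S) = (\<lambda>x. \<zero>\<^bsub>R\<^esub>)"
  "smult (free_module R S) = (\<lambda>r c x. r \<otimes>\<^bsub>R\<^esub> c x)"
  by (simp_all add: free_module_def)

context cring
begin

lemma free_module_closed:
  assumes "c \<in> carrier (free_module R S)"
  shows "c p \<in> carrier R"
  using assms by (cases "p \<in> S") (auto simp: free_module_simps)

text \<open>Bounding the support by a convenient finite set \<open>A\<close> avoids computing it
  exactly.\<close>

lemma free_module_carrierI:
  assumes "\<And>p. p \<in> S \<Longrightarrow> c p \<in> carrier R" and "{p. c p \<noteq> \<zero>} \<subseteq> A" and "A \<subseteq> S" and "finite A"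
  shows "c \<in> carrier (free_module R S)"
proof -
  have "finite {x \<in> S. c x \<noteq> \<zero>}"
    by (rule finite_subset[OF _ assms(4)]) (use assms(2) in auto)
  moreover have "c x = \<zero>" if "x \<notin> S" for x
    using that assms(2,3) by auto
  ultimately show ?thesis
    using assms(1) by (simp add: free_module_simps image_subset_iff)
qed

lemma free_module_support:
  assumes "c \<in> carrier (free_module R S)"
  shows "finite {p. c p \<noteq> \<zero>}" and "{p. c p \<noteq> \<zero>} \<subseteq> S"
proof -
  show sub: "{p. c p \<noteq> \<zero>} \<subseteq> S"
    using assms by (auto simp: free_module_simps)
  then have "{p. c p \<noteq> \<zero>} = {x \<in> S. c x \<noteq> \<zero>}" by auto
  then show "finite {p. c p \<noteq> \<zero>}"
    using assms by (simp add: free_module_simps)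
qed

lemma free_module_add_closed:
  assumes c: "c \<in> carrier (free_module R S)" and d: "d \<in> carrier (free_module R S)"
  shows "(\<lambda>p. c p \<oplus> d p) \<in> carrier (free_module R S)"
proof (rule free_module_carrierI)
  show "{p. c p \<oplus> d p \<noteq> \<zero>} \<subseteq> {p. c p \<noteq> \<zero>} \<union> {p. d p \<noteq> \<zero>}"
    by auto
qed (use free_module_support[OF c] free_module_support[OF d] free_module_closed[OF c]
      free_module_closed[OF d] in simp_all)

lemma free_module_smult_closed:
  assumes r: "r \<in> carrier R" and c: "c \<in> carrier (free_module R S)"
  shows "(\<lambda>p. r \<otimes> c p) \<in> carrier (free_module R S)"
proof (rule free_module_carrierI)
  show "{p. r \<otimes> c p \<noteq> \<zero>} \<subseteq> {p. c p \<noteq> \<zero>}"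
    using r by auto
qed (use r free_module_support[OF c] free_module_closed[OF c] in simp_all)

lemma free_module_is_module: "module R (free_module R S)"
proof (rule moduleI[OF cring_axioms])
  show "abelian_group (free_module R S)"
  proof (rule abelian_groupI)
    fix c assume c: "c \<in> carrier (free_module R S)"
    have "(\<lambda>p. \<ominus> \<one> \<otimes> c p) \<in> carrier (free_module R S)"
      by (rule free_module_smult_closed[OF _ c]) simp
    moreover have "(\<lambda>p. \<ominus> \<one> \<otimes> c p) \<oplus>\<^bsub>free_module R S\<^esub> c = \<zero>\<^bsub>free_module R S\<^esub>"
      using free_module_closed[OF c] by (simp add: free_module_simps fun_eq_iff l_minus l_neg)
    ultimately show "\<exists>d\<in>carrier (free_module R S). d \<oplus>\<^bsub>free_module R S\<^esub> c = \<zero>\<^bsub>free_module R S\<^esub>"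
      by (intro bexI[of _ "\<lambda>p. \<ominus> \<one> \<otimes> c p"])
    show "\<zero>\<^bsub>free_module R S\<^esub> \<oplus>\<^bsub>free_module R S\<^esub> c = c"
      using free_module_closed[OF c] by (simp add: free_module_simps)
  next
    show "\<zero>\<^bsub>free_module R S\<^esub> \<in> carrier (free_module R S)"
      by (simp add: free_module_simps image_subset_iff)
  next
    fix c d assume c: "c \<in> carrier (free_module R S)" and d: "d \<in> carrier (free_module R S)"
    show "c \<oplus>\<^bsub>free_module R S\<^esub> d \<in> carrier (free_module R S)"
      using free_module_add_closed[OF c d] by (simp add: free_module_simps(2))
    show "c \<oplus>\<^bsub>free_module R S\<^esub> d = d \<oplus>\<^bsub>free_module R S\<^esub> c"
      using free_module_closed[OF c] free_module_closed[OF d]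
      by (simp add: free_module_simps(2) fun_eq_iff a_comm)
    fix e assume e: "e \<in> carrier (free_module R S)"
    show "c \<oplus>\<^bsub>free_module R S\<^esub> d \<oplus>\<^bsub>free_module R S\<^esub> e
        = c \<oplus>\<^bsub>free_module R S\<^esub> (d \<oplus>\<^bsub>free_module R S\<^esub> e)"
      using free_module_closed[OF c] free_module_closed[OF d] free_module_closed[OF e]
      by (simp add: free_module_simps(2) fun_eq_iff a_assoc)
  qed
next
  fix r c assume "r \<in> carrier R" "c \<in> carrier (free_module R S)"
  then show "r \<odot>\<^bsub>free_module R S\<^esub> c \<in> carrier (free_module R S)"
    using free_module_smult_closed by (simp add: free_module_simps(4))
qed (simp_all add: free_module_simps(2,4) fun_eq_iff free_module_closed l_distr r_distr m_assoc)

lemma free_generator_closed: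
  assumes "p \<in> S"
  shows "free_generator R p \<in> carrier (free_module R S)"
  by (rule free_module_carrierI[of _ _ "{p}"]) (use assms in \<open>auto simp: free_generator_def\<close>)

text \<open>The linear functional on the free module with values \<open>b\<close> on the generators.
  Summing over the whole support keeps the index set out of the definition.\<close>

definition eval_free :: "('i \<Rightarrow> 'a) \<Rightarrow> ('i \<Rightarrow> 'a) \<Rightarrow> 'a" where
  "eval_free b c = (\<Oplus>p\<in>{p. c p \<noteq> \<zero>}. c p \<otimes> b p)"

text \<open>Terms outside the support vanish. The freedom in \<open>A\<close> allows sums for
  elements with different supports to be compared.\<close>

lemma eval_free_superset:
  assumes c: "c \<in> carrier (free_module R S)" and b: "b \<in> S \<rightarrow> carrier R"
    and A: "{p. c p \<noteq> \<zero>} \<subseteq> A" "A \<subseteq> S" "finite A"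
  shows "eval_free b c = (\<Oplus>p\<in>A. c p \<otimes> b p)"
proof -
  have bA: "b p \<in> carrier R" if "p \<in> A" for p
    using that A(2) b by auto
  show ?thesis
    unfolding eval_free_def
    by (rule add.finprod_mono_neutral_cong_left[OF A(3,1)])
      (use bA free_module_closed[OF c] in auto)
qed

lemma eval_free_hom:
  assumes b: "b \<in> S \<rightarrow> carrier R"
  shows "eval_free b \<in> module_homs R (free_module R S) (ring_module R)"
proof (rule module_homsI)
  fix c assume c: "c \<in> carrier (free_module R S)"
  note supp = free_module_support[OF c] and cR = free_module_closed[OF c]
  have bR: "b p \<in> carrier R" if "p \<in> S" for p
    using that b by auto
  have "eval_free b c \<in> carrier R"
    unfolding eval_free_def using supp cR bR by (intro finsum_closed) auto
  then show "eval_free b c \<in> carrier (ring_module R)"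
    by simp
  {
    fix d assume d: "d \<in> carrier (free_module R S)"
    note supp' = free_module_support[OF d] and dR = free_module_closed[OF d]
    \<comment> \<open>The support of a sum can shrink by cancellation, so all three sums are taken
      over the union of the two supports.\<close>
    let ?A = "{p. c p \<noteq> \<zero>} \<union> {p. d p \<noteq> \<zero>}"
    have A: "finite ?A" "?A \<subseteq> S" using supp supp' by auto
    have bA: "b p \<in> carrier R" if "p \<in> ?A" for p
      using that A(2) bR by blast
    have "eval_free b (\<lambda>p. c p \<oplus> d p) = (\<Oplus>p\<in>?A. (c p \<oplus> d p) \<otimes> b p)"
      by (rule eval_free_superset[OF free_module_add_closed[OF c d] b _ A(2,1)]) auto
    also have "\<dots> = (\<Oplus>p\<in>?A. c p \<otimes> b p \<oplus> d p \<otimes> b p)"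
      using cR dR bA by (intro finsum_cong') (auto simp: l_distr)
    also have "\<dots> = (\<Oplus>p\<in>?A. c p \<otimes> b p) \<oplus> (\<Oplus>p\<in>?A. d p \<otimes> b p)"
      using cR dR bA by (intro finsum_addf) auto
    also have "\<dots> = eval_free b c \<oplus> eval_free b d"
      using eval_free_superset[OF c b _ A(2,1)] eval_free_superset[OF d b _ A(2,1)] by simp
    finally show "eval_free b (c \<oplus>\<^bsub>free_module R S\<^esub> d)
        = eval_free b c \<oplus>\<^bsub>ring_module R\<^esub> eval_free b d"
      by (simp add: free_module_simps(2))
  next
    fix r assume r: "r \<in> carrier R"
    have "eval_free b (\<lambda>p. r \<otimes> c p) = (\<Oplus>p\<in>{p. c p \<noteq> \<zero>}. (r \<otimes> c p) \<otimes> b p)"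
      by (rule eval_free_superset[OF free_module_smult_closed[OF r c] b _ supp(2,1)]) (use r in auto)
    also have "\<dots> = (\<Oplus>p\<in>{p. c p \<noteq> \<zero>}. r \<otimes> (c p \<otimes> b p))"
      using r cR bR supp(2) by (intro finsum_cong') (auto simp: m_assoc)
    also have "\<dots> = r \<otimes> eval_free b c"
      unfolding eval_free_def using r cR bR supp by (intro finsum_rdistr[symmetric]) auto
    finally show "eval_free b (r \<odot>\<^bsub>free_module R S\<^esub> c) = r \<odot>\<^bsub>ring_module R\<^esub> eval_free b c"
      by (simp add: free_module_simps(4))
  }
qed

lemma eval_free_generator:
  assumes p: "p \<in> S" and b: "b \<in> S \<rightarrow> carrier R"
  shows "eval_free b (free_generator R p) = b p"
proof -
  have bp: "b p \<in> carrier R" using p b by auto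
  have "eval_free b (free_generator R p) = (\<Oplus>q\<in>{p}. free_generator R p q \<otimes> b q)"
    by (rule eval_free_superset[OF free_generator_closed[OF p] b])
      (use p in \<open>auto simp: free_generator_def\<close>)
  also have "\<dots> = b p"
    using bp by (simp add: free_generator_def)
  finally show ?thesis .
qed

end

section \<open>Submodules, cosets and homomorphisms into the ring\<close>

context module
begin

lemma submodule_minus_closed:
  assumes "submodule S R M" and "u \<in> S" and "v \<in> S"
  shows "u \<ominus>\<^bsub>M\<^esub> v \<in> S"
  using submoduleE(5)[OF assms(1,2) submoduleE(3)[OF assms(1,3)]] by (simp add: a_minus_def)

lemma submodule_zero_closed:
  assumes "submodule S R M"
  shows "\<zero>\<^bsub>M\<^esub> \<in> S"
  using subgroup.one_closed[OF submodule.axioms(1)[OF assms]] by simp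

lemma submodule_abelian_subgroup:
  assumes "submodule S R M"
  shows "abelian_subgroup S M"
  by (rule abelian_subgroupI3[OF additive_subgroupI[OF submodule.axioms(1)[OF assms]]])
    (rule M.abelian_group_axioms)

lemma submodule_coset_eq_iff:
  assumes S: "submodule S R M" and u: "u \<in> carrier M" and v: "v \<in> carrier M"
  shows "S +>\<^bsub>M\<^esub> u = S +>\<^bsub>M\<^esub> v \<longleftrightarrow> u \<ominus>\<^bsub>M\<^esub> v \<in> S"
proof -
  interpret S: abelian_subgroup S M by (rule submodule_abelian_subgroup[OF S])
  have "u \<ominus>\<^bsub>M\<^esub> v \<in> S \<longleftrightarrow> u \<in> S +>\<^bsub>M\<^esub> v"
    using S.a_rcos_module[OF v u] by (simp add: a_minus_def)
  then show ?thesis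
    using S.a_repr_independence'[of u v] S.a_rcos_self[OF u] v by auto
qed

lemma generated_submodule_superset: "G \<subseteq> generated_submodule R M G"
  unfolding generated_submodule_def by auto

lemma generated_submodule_least:
  assumes "submodule S R M" and "G \<subseteq> S"
  shows "generated_submodule R M G \<subseteq> S"
  unfolding generated_submodule_def using assms by auto

lemma generated_submodule_is_submodule:
  assumes "G \<subseteq> carrier M"
  shows "submodule (generated_submodule R M G) R M"
proof (rule submoduleI)
  show "generated_submodule R M G \<subseteq> carrier M"
    by (rule generated_submodule_least[OF carrier_is_submodule assms])
qed (auto simp: generated_submodule_def submodule_zero_closed submoduleE)

text \<open>The coset of \<open>c\<close> is nonzero and killed by \<open>r\<close>. Scalar
  multiplication in the quotient is a union over all representatives, so each of them has to be sent
  into \<open>S\<close>.\<close>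

lemma torsion_quotient_nontrivial:
  assumes S: "submodule S R M" and c: "c \<in> carrier M" "c \<notin> S"
    and r: "r \<in> carrier R" "r \<noteq> \<zero>" and rc: "r \<odot>\<^bsub>M\<^esub> c \<in> S"
  shows "torsion_submodule R (quotient_module M S) \<noteq> {\<zero>\<^bsub>quotient_module M S\<^esub>}"
proof -
  interpret S: abelian_subgroup S M by (rule submodule_abelian_subgroup[OF S])
  let ?C = "S +>\<^bsub>M\<^esub> c"
  have cC: "c \<in> ?C" by (rule S.a_rcos_self[OF c(1)])
  have const: "S +>\<^bsub>M\<^esub> (r \<odot>\<^bsub>M\<^esub> x) = S" if x: "x \<in> ?C" for x
  proof -
    obtain s where s: "s \<in> S" "x = s \<oplus>\<^bsub>M\<^esub> c"
      using x unfolding a_r_coset_def' by blast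
    have "s \<in> carrier M" using s(1) submoduleE(1)[OF S] by auto
    then have "r \<odot>\<^bsub>M\<^esub> x = r \<odot>\<^bsub>M\<^esub> s \<oplus>\<^bsub>M\<^esub> r \<odot>\<^bsub>M\<^esub> c"
      using r c s by (simp add: smult_r_distr)
    also have "\<dots> \<in> S"
      by (rule submoduleE(5)[OF S submoduleE(4)[OF S r(1) s(1)] rc])
    finally show ?thesis by (rule S.a_rcos_const)
  qed
  have "(\<Union>x\<in>?C. S +>\<^bsub>M\<^esub> (r \<odot>\<^bsub>M\<^esub> x)) = (\<Union>x\<in>?C. S)"
    using const by (intro SUP_cong refl) auto
  also have "\<dots> = S" using cC by auto
  finally have "r \<odot>\<^bsub>quotient_module M S\<^esub> ?C = \<zero>\<^bsub>quotient_module M S\<^esub>"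
    by (simp add: quotient_module_def)
  moreover have "?C \<in> carrier (quotient_module M S)"
    using a_rcosetsI[OF submoduleE(1)[OF S] c(1)] by (simp add: quotient_module_def)
  ultimately have "?C \<in> torsion_submodule R (quotient_module M S)"
    using r unfolding torsion_submodule_def by auto
  moreover have "?C \<noteq> \<zero>\<^bsub>quotient_module M S\<^esub>"
    using cC c(2) by (auto simp: quotient_module_def)
  ultimately show ?thesis by auto
qed

text \<open>Zero and negatives are handled as multiples by the scalars \<open>\<zero>\<close> and
  \<open>\<ominus> \<one>\<close>.\<close>

lemma hom_to_ring_zero_minus:
  assumes h: "h \<in> module_homs R M (ring_module R)"
  shows "h \<zero>\<^bsub>M\<^esub> = \<zero>" and "x \<in> carrier M \<Longrightarrow> h (\<ominus>\<^bsub>M\<^esub> x) = \<ominus> h x"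
    and "x \<in> carrier M \<Longrightarrow> y \<in> carrier M \<Longrightarrow> h (x \<ominus>\<^bsub>M\<^esub> y) = h x \<ominus> h y"
proof -
  have hR: "h x \<in> carrier R" if "x \<in> carrier M" for x
    using module_homsD(1)[OF h that] by simp
  show "h \<zero>\<^bsub>M\<^esub> = \<zero>"
    using module_homsD(3)[OF h R.zero_closed M.zero_closed] hR[OF M.zero_closed] by simp
  have minus: "h (\<ominus>\<^bsub>M\<^esub> x) = \<ominus> h x" if "x \<in> carrier M" for x
    using module_homsD(3)[OF h R.add.inv_closed[OF R.one_closed] that] that hR[OF that]
    by (simp add: smult_l_minus l_minus)
  then show "x \<in> carrier M \<Longrightarrow> h (\<ominus>\<^bsub>M\<^esub> x) = \<ominus> h x" .
  show "h (x \<ominus>\<^bsub>M\<^esub> y) = h x \<ominus> h y" if "x \<in> carrier M" "y \<in> carrier M"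
    using that module_homsD(2)[OF h] minus by (simp add: a_minus_def)
qed

lemma hom_to_ring_image_ideal:
  assumes h: "h \<in> module_homs R M (ring_module R)"
  shows "ideal (h ` carrier M) R"
proof -
  have l: "r \<otimes> y \<in> h ` carrier M" if y: "y \<in> h ` carrier M" and r: "r \<in> carrier R" for r y
  proof -
    obtain u where u: "u \<in> carrier M" "y = h u" using y by auto
    then have "r \<otimes> y = h (r \<odot>\<^bsub>M\<^esub> u)" using module_homsD(3)[OF h r u(1)] by simp
    then show ?thesis using u r by auto
  qed
  have sub: "h ` carrier M \<subseteq> carrier R" using module_homsD(1)[OF h] by auto
  show ?thesis
  proof (rule idealI[OF R.ring_axioms])
    show "subgroup (h ` carrier M) (add_monoid R)"
    proof (rule R.add.subgroupI)
      fix y assume "y \<in> h ` carrier M"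
      then obtain u where u: "u \<in> carrier M" "y = h u" by auto
      then have "\<ominus> y = h (\<ominus>\<^bsub>M\<^esub> u)" using hom_to_ring_zero_minus(2)[OF h] by simp
      then show "\<ominus> y \<in> h ` carrier M" using u by auto
    next
      fix y z assume "y \<in> h ` carrier M" "z \<in> h ` carrier M"
      then obtain u v where u: "u \<in> carrier M" "y = h u" "v \<in> carrier M" "z = h v" by auto
      then have "y \<oplus> z = h (u \<oplus>\<^bsub>M\<^esub> v)" using module_homsD(2)[OF h] by simp
      then show "y \<oplus> z \<in> h ` carrier M" using u by auto
    qed (use sub M.zero_closed in auto)
    show "y \<otimes> r \<in> h ` carrier M" if y: "y \<in> h ` carrier M" and r: "r \<in> carrier R" for r y
      using l[OF y r] m_comm[of y r] y r sub by auto
  qed (rule l)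
qed

text \<open>This is the kernel of the map into \<open>R / J\<close> induced by \<open>h\<close>. It
  allows a statement about a generated submodule to be checked on generators.\<close>

lemma hom_to_ring_preimage_submodule:
  assumes h: "h \<in> module_homs R M (ring_module R)" and J: "ideal J R"
  shows "submodule {c \<in> carrier M. h c \<in> J} R M"
proof -
  interpret J: ideal J R by fact
  show ?thesis
    by (rule submoduleI)
      (auto simp: hom_to_ring_zero_minus[OF h] module_homsD(2,3)[OF h] J.I_l_closed)
qed

end

section \<open>Bilinear maps modulo an ideal and the tensor product\<close>

definition bilinear_modulo ::
  "('a, 'r) ring_scheme \<Rightarrow> 'a set \<Rightarrow> ('a, 'm, 'x) module_scheme \<Rightarrow> ('a, 'n, 'y) module_scheme
    \<Rightarrow> ('m \<times> 'n \<Rightarrow> 'a) \<Rightarrow> bool" where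
  "bilinear_modulo R J M N b \<longleftrightarrow> b \<in> carrier M \<times> carrier N \<rightarrow> carrier R \<and>
     (\<forall>x\<in>carrier M. \<forall>x'\<in>carrier M. \<forall>y\<in>carrier N.
        b (x \<oplus>\<^bsub>M\<^esub> x', y) \<ominus>\<^bsub>R\<^esub> (b (x, y) \<oplus>\<^bsub>R\<^esub> b (x', y)) \<in> J) \<and>
     (\<forall>x\<in>carrier M. \<forall>y\<in>carrier N. \<forall>y'\<in>carrier N.
        b (x, y \<oplus>\<^bsub>N\<^esub> y') \<ominus>\<^bsub>R\<^esub> (b (x, y) \<oplus>\<^bsub>R\<^esub> b (x, y')) \<in> J) \<and>
     (\<forall>r\<in>carrier R. \<forall>x\<in>carrier M. \<forall>y\<in>carrier N.
        b (r \<odot>\<^bsub>M\<^esub> x, y) \<ominus>\<^bsub>R\<^esub> r \<otimes>\<^bsub>R\<^esub> b (x, y) \<in> J \<and>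
        b (x, r \<odot>\<^bsub>N\<^esub> y) \<ominus>\<^bsub>R\<^esub> r \<otimes>\<^bsub>R\<^esub> b (x, y) \<in> J)"

text \<open>The tensor product is the quotient of \<open>F\<close> by \<open>K\<close>, and the pure
  tensors are the cosets of the elements \<open>e x y\<close>. Computations take place in
  \<open>F\<close> and compare cosets of \<open>K\<close>.\<close>

locale module_pair = M: module R M + N: module R N
  for R :: "('a, 'r) ring_scheme" (structure) and M :: "('a, 'm, 'x) module_scheme"
    and N :: "('a, 'n, 'y) module_scheme"
begin

abbreviation "F \<equiv> free_module R (carrier M \<times> carrier N)"
abbreviation "K \<equiv> generated_submodule R F (tensor_relations R M N)"
abbreviation "e x y \<equiv> free_generator R (x, y)"

sublocale F: module R F
  by (rule M.free_module_is_module)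

lemma generator_closed:
  "x \<in> carrier M \<Longrightarrow> y \<in> carrier N \<Longrightarrow> e x y \<in> carrier F"
  by (rule M.free_generator_closed) simp

lemma tensor_relations_subset: "tensor_relations R M N \<subseteq> carrier F"
  by (auto simp: tensor_relations_def Let_def generator_closed)

lemma tensor_kernel_submodule: "submodule K R F"
  by (rule F.generated_submodule_is_submodule[OF tensor_relations_subset])

text \<open>The two elements differ by a defining relation. Together with the version for the right
  factor this moves scalars across a pure tensor.\<close>

lemma tensor_coset_smult_left:
  assumes "r \<in> carrier R" "x \<in> carrier M" "y \<in> carrier N"
  shows "K +>\<^bsub>F\<^esub> e (r \<odot>\<^bsub>M\<^esub> x) y = K +>\<^bsub>F\<^esub> (r \<odot>\<^bsub>F\<^esub> e x y)"
proof -
  have "e (r \<odot>\<^bsub>M\<^esub> x) y \<ominus>\<^bsub>F\<^esub> r \<odot>\<^bsub>F\<^esub> e x y \<in> tensor_relations R M N"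
    using assms unfolding tensor_relations_def Let_def by blast
  then show ?thesis
    using F.generated_submodule_superset assms generator_closed
    by (subst F.submodule_coset_eq_iff[OF tensor_kernel_submodule]) auto
qed

lemma tensor_coset_smult_right:
  assumes "r \<in> carrier R" "x \<in> carrier M" "y \<in> carrier N"
  shows "K +>\<^bsub>F\<^esub> e x (r \<odot>\<^bsub>N\<^esub> y) = K +>\<^bsub>F\<^esub> (r \<odot>\<^bsub>F\<^esub> e x y)"
proof -
  have "e x (r \<odot>\<^bsub>N\<^esub> y) \<ominus>\<^bsub>F\<^esub> r \<odot>\<^bsub>F\<^esub> e x y \<in> tensor_relations R M N"
    using assms unfolding tensor_relations_def Let_def by blast
  then show ?thesis
    using F.generated_submodule_superset assms generator_closed
    by (subst F.submodule_coset_eq_iff[OF tensor_kernel_submodule]) auto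
qed

text \<open>The clauses of \<open>bilinear_modulo\<close> mirror the defining relations one by one,
  so the linear extension of \<open>b\<close> sends each relation into \<open>J\<close>. Thus
  \<open>b\<close> induces a map from the tensor product to \<open>R / J\<close>, which can certify
  that an element is nonzero.\<close>

lemma bilinear_modulo_kernel:
  assumes J: "ideal J R" and b: "bilinear_modulo R J M N b" and c: "c \<in> K"
  shows "M.eval_free b c \<in> J"
proof -
  have bc: "b \<in> carrier M \<times> carrier N \<rightarrow> carrier R"
    using b unfolding bilinear_modulo_def by simp
  note hom = M.eval_free_hom[OF bc]
  have gen: "M.eval_free b (e x y) = b (x, y)" if "x \<in> carrier M" "y \<in> carrier N" for x y
    using that by (intro M.eval_free_generator[OF _ bc]) simp
  note eval = F.hom_to_ring_zero_minus(3)[OF hom] module_homsD(2,3)[OF hom] gen generator_closed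
  have "tensor_relations R M N \<subseteq> {c \<in> carrier F. M.eval_free b c \<in> J}"
    using b unfolding bilinear_modulo_def tensor_relations_def Let_def
    by (auto simp: eval)
  then have "K \<subseteq> {c \<in> carrier F. M.eval_free b c \<in> J}"
    by (intro F.generated_submodule_least F.hom_to_ring_preimage_submodule[OF hom J])
  then show ?thesis using c by auto
qed

end

section \<open>Trace ideals\<close>

text \<open>The element \<open>b\<close> alone is a basis: \<open>gen\<close> says that it spans and
  \<open>inj\<close> that its coefficient is unique.\<close>

lemma (in cring) free_ideal_module_singleton:
  assumes I: "ideal I R" and b: "b \<in> I"
    and gen: "\<And>i. i \<in> I \<Longrightarrow> \<exists>c\<in>carrier R. i = c \<otimes> b"
    and inj: "\<And>c d. c \<in> carrier R \<Longrightarrow> d \<in> carrier R \<Longrightarrow> c \<otimes> b = d \<otimes> b \<Longrightarrow> c = d"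
  shows "is_free_module R (ideal_module R I)"
proof -
  interpret I: ideal I R by fact
  interpret M: module R "ideal_module R I" by (rule ideal_module_is_module[OF I])
  have bR: "b \<in> carrier R" using b I.a_subset by auto
  let ?F = "free_module R {b}"
  have cR: "c b \<in> carrier R" if "c \<in> carrier ?F" for c
    using free_module_closed[OF that] .
  have sum: "(\<Oplus>\<^bsub>ideal_module R I\<^esub>x\<in>{x \<in> {b}. c x \<noteq> \<zero>}. c x \<odot>\<^bsub>ideal_module R I\<^esub> x) = c b \<otimes> b"
    if c: "c \<in> carrier ?F" for c
  \<comment> \<open>The sum runs over the support of \<open>c\<close>, which is empty or all of
    \<open>{b}\<close>.\<close>
  proof (cases "c b = \<zero>")
    case True
    then have "{x \<in> {b}. c x \<noteq> \<zero>} = {}" by auto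
    then show ?thesis using True bR by (simp only: M.finsum_empty) simp
  next
    case False
    then have "{x \<in> {b}. c x \<noteq> \<zero>} = {b}" by auto
    then show ?thesis
      using M.finsum_insert[of "{}" b "\<lambda>x. c x \<odot>\<^bsub>ideal_module R I\<^esub> x"] b cR[OF c] bR
      by (simp add: I.I_l_closed)
  qed
  have "bij_betw (\<lambda>c. c b \<otimes> b) (carrier ?F) I"
  proof (rule bij_betw_imageI)
    show "inj_on (\<lambda>c. c b \<otimes> b) (carrier ?F)"
    proof (rule inj_onI)
      fix c d assume c: "c \<in> carrier ?F" and d: "d \<in> carrier ?F" and "c b \<otimes> b = d b \<otimes> b"
      then have "c b = d b" using inj cR by auto
      moreover have "c x = \<zero> \<and> d x = \<zero>" if "x \<noteq> b" for x
        using that c d by (auto simp: free_module_simps)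
      ultimately show "c = d"
        by (intro ext) metis
    qed
    show "(\<lambda>c. c b \<otimes> b) ` carrier ?F = I"
    proof
      show "(\<lambda>c. c b \<otimes> b) ` carrier ?F \<subseteq> I"
        using cR b I.I_l_closed by auto
      show "I \<subseteq> (\<lambda>c. c b \<otimes> b) ` carrier ?F"
      proof
        fix i assume "i \<in> I"
        then obtain r where r: "r \<in> carrier R" "i = r \<otimes> b" using gen by auto
        let ?c = "\<lambda>x. if x = b then r else \<zero>"
        have "?c \<in> carrier ?F"
          by (rule free_module_carrierI[of _ _ "{b}"]) (use r in auto)
        moreover have "i = ?c b \<otimes> b" using r by simp
        ultimately show "i \<in> (\<lambda>c. c b \<otimes> b) ` carrier ?F" by (intro image_eqI[of _ _ ?c])
      qed
    qed
  qed
  then have "bij_betw (\<lambda>c. \<Oplus>\<^bsub>ideal_module R I\<^esub>x\<in>{x \<in> {b}. c x \<noteq> \<zero>}. c x \<odot>\<^bsub>ideal_module R I\<^esub> x)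
      (carrier ?F) (carrier (ideal_module R I))"
    using sum by (subst bij_betw_cong[of _ _ "\<lambda>c. c b \<otimes> b"]) simp_all
  then show ?thesis
    unfolding is_free_module_def using b by (intro exI[of _ "{b}"]) simp
qed

lemma trace_idealI:
  fixes k :: nat
  assumes "\<And>i. i < k \<Longrightarrow> \<alpha> i \<in> carrier (dual_module R N)" and "\<And>i. i < k \<Longrightarrow> x i \<in> carrier N"
  shows "(\<Oplus>\<^bsub>R\<^esub>i\<in>{..<k}. \<alpha> i (x i)) \<in> trace_ideal R N"
  unfolding trace_ideal_def using assms by blast

lemma dual_module_closed:
  assumes "\<alpha> \<in> carrier (dual_module R N)" and "x \<in> carrier N"
  shows "\<alpha> x \<in> carrier R"
  using assms module_homsD(1)[of \<alpha> R N "ring_module R"] by (simp add: dual_module_def)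

lemma (in cring) trace_ideal_subset: "trace_ideal R N \<subseteq> carrier R"
  unfolding trace_ideal_def by (auto intro!: finsum_closed simp: dual_module_closed)

lemma restrict_in_hom_module:
  assumes "module R M" and f: "f \<in> module_homs R M N"
  shows "restrict f (carrier M) \<in> carrier (hom_module R M N)"
proof -
  interpret M: module R M by fact
  have "restrict f (carrier M) \<in> module_homs R M N"
    by (rule module_homsI) (simp_all add: module_homsD[OF f])
  then show ?thesis by simp
qed

text \<open>The image of a functional on \<open>N\<close> lies in the trace ideal, so following it
  by \<open>f\<close> gives another functional on \<open>N\<close>. Hence \<open>f\<close> sends a
  sum of values of functionals to a sum of the same kind.\<close>

lemma (in cring) trace_ideal_hom_closed:
  assumes N: "module R N"
    and f: "f \<in> module_homs R (ideal_module R (trace_ideal R N)) (ring_module R)"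
    and t: "t \<in> trace_ideal R N"
  shows "f t \<in> trace_ideal R N"
proof -
  note fR = module_homsD(1)[OF f, simplified] and fadd = module_homsD(2)[OF f, simplified]
    and fmult = module_homsD(3)[OF f, simplified]
  obtain k :: nat and \<alpha> x where \<alpha>: "\<And>i. i < k \<Longrightarrow> \<alpha> i \<in> carrier (dual_module R N)"
    and x: "\<And>i. i < k \<Longrightarrow> x i \<in> carrier N" and t_eq: "t = (\<Oplus>i\<in>{..<k}. \<alpha> i (x i))"
    using t unfolding trace_ideal_def by auto
  have one: "a y \<in> trace_ideal R N" if "a \<in> carrier (dual_module R N)" "y \<in> carrier N" for a y
    using trace_idealI[of 1 "\<lambda>_. a" R N "\<lambda>_. y"] that dual_module_closed[OF that]
    by (simp add: lessThan_Suc)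
  have zero: "\<zero> \<in> trace_ideal R N"
    using trace_idealI[of 0 \<alpha> R N x] by simp
  \<comment> \<open>As \<open>f\<close> is additive only on the trace ideal, the induction goes over
    partial sums, each of which lies in that ideal.\<close>
  have "f (\<Oplus>i\<in>{..<j}. \<alpha> i (x i)) = (\<Oplus>i\<in>{..<j}. f (\<alpha> i (x i)))" if "j \<le> k" for j
    using that
  proof (induction j)
    case 0
    show ?case using fmult[OF zero_closed zero] fR[OF zero] by simp
  next
    case (Suc j)
    have \<alpha>': "\<alpha> i (x i) \<in> carrier R" "\<alpha> i (x i) \<in> trace_ideal R N" if "i < Suc j" for i
      using that Suc.prems dual_module_closed[OF \<alpha> x] one[OF \<alpha> x] by simp_all
    have part: "(\<Oplus>i\<in>{..<j}. \<alpha> i (x i)) \<in> trace_ideal R N"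
      using Suc.prems by (intro trace_idealI \<alpha> x) simp_all
    then have partR: "(\<Oplus>i\<in>{..<j}. \<alpha> i (x i)) \<in> carrier R"
      using trace_ideal_subset by auto
    have "(\<Oplus>i\<in>{..<Suc j}. \<alpha> i (x i)) = \<alpha> j (x j) \<oplus> (\<Oplus>i\<in>{..<j}. \<alpha> i (x i))"
      unfolding lessThan_Suc using \<alpha>' by (intro finsum_insert) auto
    then have "f (\<Oplus>i\<in>{..<Suc j}. \<alpha> i (x i)) = f (\<alpha> j (x j)) \<oplus> (\<Oplus>i\<in>{..<j}. f (\<alpha> i (x i)))"
      using fadd[OF \<alpha>'(2) part] Suc by simp
    also have "\<dots> = (\<Oplus>i\<in>{..<Suc j}. f (\<alpha> i (x i)))"
      unfolding lessThan_Suc using \<alpha>' fR by (intro finsum_insert[symmetric]) auto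
    finally show ?case .
  qed
  then have "f t = (\<Oplus>i\<in>{..<k}. f (\<alpha> i (x i)))"
    unfolding t_eq by simp
  \<comment> \<open>Elements of the dual are undefined off the carrier, so the composite is
    restricted; the values at the \<open>x i\<close> are unaffected.\<close>
  also have "\<dots> = (\<Oplus>i\<in>{..<k}. (\<lambda>y\<in>carrier N. f (\<alpha> i y)) (x i))"
    using x \<alpha> fR one by (intro finsum_cong') auto
  also have "\<dots> \<in> trace_ideal R N"
  proof (rule trace_idealI)
    fix i assume i: "i < k"
    then have a: "\<alpha> i \<in> module_homs R N (ring_module R)"
      using \<alpha>[OF i] by (simp add: dual_module_def)
    \<comment> \<open>The codomain of \<open>\<alpha> i\<close> is narrowed from \<open>R\<close> to
      the trace ideal, where \<open>f\<close> is defined.\<close>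
    have h: "\<alpha> i \<in> module_homs R N (ideal_module R (trace_ideal R N))"
      by (rule module_homsI) (simp_all add: module_homsD(2,3)[OF a] one \<alpha>[OF i])
    show "(\<lambda>y\<in>carrier N. f (\<alpha> i y)) \<in> carrier (dual_module R N)"
      using restrict_in_hom_module[OF N module_homs_compose[OF h f]] unfolding dual_module_def .
  qed (rule x)
  finally show ?thesis .
qed

lemma module_homs_inv:
  assumes f: "f \<in> module_homs R M N" and bij: "bij_betw f (carrier M) (carrier N)" and "module R M"
  shows "inv_into (carrier M) f \<in> module_homs R N M"
proof -
  interpret M: module R M by fact
  let ?g = "inv_into (carrier M) f"
  have g: "?g y \<in> carrier M" "f (?g y) = y" if "y \<in> carrier N" for y
    using bij that by (auto simp: bij_betw_def f_inv_into_f inv_into_into)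
  have gf: "?g (f x) = x" if "x \<in> carrier M" for x
    using bij that by (auto simp: bij_betw_def)
  show ?thesis
  proof (rule module_homsI)
    fix x y assume xy: "x \<in> carrier N" "y \<in> carrier N"
    have "f (?g x \<oplus>\<^bsub>M\<^esub> ?g y) = x \<oplus>\<^bsub>N\<^esub> y"
      using xy g by (simp add: module_homsD(2)[OF f])
    then show "?g (x \<oplus>\<^bsub>N\<^esub> y) = ?g x \<oplus>\<^bsub>M\<^esub> ?g y"
      using gf[of "?g x \<oplus>\<^bsub>M\<^esub> ?g y"] g xy by simp
  next
    fix r x assume rx: "r \<in> carrier R" "x \<in> carrier N"
    have "f (r \<odot>\<^bsub>M\<^esub> ?g x) = r \<odot>\<^bsub>N\<^esub> x"
      using rx g by (simp add: module_homsD(3)[OF f])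
    then show "?g (r \<odot>\<^bsub>N\<^esub> x) = r \<odot>\<^bsub>M\<^esub> ?g x"
      using gf[of "r \<odot>\<^bsub>M\<^esub> ?g x"] g rx by simp
  qed (rule g(1))
qed

section \<open>Torsion in the tensor product\<close>

context noetherian_local_ring
begin

text \<open>The trace ideal enters only through \<open>tr\<close>, and the failure of freeness only
  through \<open>proper\<close>.\<close>

lemma tensor_dual_torsion:
  assumes "domain R" and dim: "krull_dimension R = 1"
    and I: "ideal I R" and I0: "I \<noteq> {\<zero>}"
    and f: "f \<in> module_homs R (ideal_module R I) (ring_module R)" and inj: "inj_on f I"
    and tr: "\<And>\<phi>. \<phi> \<in> module_homs R (ideal_module R I) (ring_module R) \<Longrightarrow> \<phi> ` I \<subseteq> f ` I"
    and proper: "f ` I \<noteq> carrier R"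
  shows "torsion_submodule R (tensor_module R (ideal_module R I) (dual_module R (ideal_module R I)))
    \<noteq> {\<zero>\<^bsub>tensor_module R (ideal_module R I) (dual_module R (ideal_module R I))\<^esub>}"
proof -
  interpret domain R by fact
  interpret I: ideal I R by fact
  interpret m: ideal \<mm> R using maximal by (rule maximalideal.axioms)
  define M where "M = ideal_module R I"
  define D where "D = dual_module R M"
  have M: "module R M"
    unfolding M_def by (rule ideal_module_is_module[OF I])
  have D: "module R D"
    unfolding D_def dual_module_def by (rule hom_module_is_module[OF M ring_module_is_module])
  interpret T: module_pair R M D
    by (intro module_pair.intro M D)
  note [simp del] = hom_module_simps(1)
  have M_simps [simp]: "carrier M = I" "\<And>x y. x \<oplus>\<^bsub>M\<^esub> y = x \<oplus> y" "\<And>r x. r \<odot>\<^bsub>M\<^esub> x = r \<otimes> x"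
    unfolding M_def by simp_all
  have D_simps: "\<And>\<phi> \<psi> x. x \<in> I \<Longrightarrow> (\<phi> \<oplus>\<^bsub>D\<^esub> \<psi>) x = \<phi> x \<oplus> \<psi> x"
    "\<And>r \<phi> x. x \<in> I \<Longrightarrow> (r \<odot>\<^bsub>D\<^esub> \<phi>) x = r \<otimes> \<phi> x"
    unfolding D_def dual_module_def by simp_all
  let ?H = "module_homs R M (ring_module R)"
  have fH: "f \<in> ?H" using f unfolding M_def .
  have H: "\<And>x. x \<in> I \<Longrightarrow> \<phi> x \<in> carrier R"
    "\<And>x y. x \<in> I \<Longrightarrow> y \<in> I \<Longrightarrow> \<phi> (x \<oplus> y) = \<phi> x \<oplus> \<phi> y"
    "\<And>r x. r \<in> carrier R \<Longrightarrow> x \<in> I \<Longrightarrow> \<phi> (r \<otimes> x) = r \<otimes> \<phi> x"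
    if "\<phi> \<in> ?H" for \<phi>
    using module_homsD[OF that] by simp_all
  have DH: "\<phi> \<in> ?H" and Dext: "\<phi> \<in> extensional I" if "\<phi> \<in> carrier D" for \<phi>
    using that unfolding D_def dual_module_def by (simp_all add: hom_module_simps(1))
  have HD: "restrict \<phi> I \<in> carrier D" if "\<phi> \<in> ?H" for \<phi>
    using restrict_in_hom_module[OF M that] unfolding D_def dual_module_def by simp
  have IR: "x \<in> carrier R" if "x \<in> I" for x
    using that I.a_subset by auto
  \<comment> \<open>Both sides equal \<open>\<phi> (u \<otimes> v)\<close>. As \<open>R\<close> is a
    domain, a functional on \<open>I\<close> is therefore determined by its value at a single
    nonzero element.\<close>
  have swap: "u \<otimes> \<phi> v = v \<otimes> \<phi> u" if "\<phi> \<in> ?H" "u \<in> I" "v \<in> I" for \<phi> u v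
    using H(3)[OF that(1) IR that(3), of u] H(3)[OF that(1) IR that(2), of v] that IR
    by (simp add: m_comm)
  obtain a where a: "a \<in> I" "a \<noteq> \<zero>"
    using I0 I.zero_closed by auto
  have aR: "a \<in> carrier R" using a IR by simp
  have fR: "f u \<in> carrier R" if "u \<in> I" for u
    using H(1)[OF fH that] .
  have f0: "f \<zero> = \<zero>"
    using H(3)[OF fH zero_closed a(1)] aR fR[OF a(1)] by simp
  then have fa0: "f a \<noteq> \<zero>"
    using inj_onD[OF inj, of a \<zero>] a I.zero_closed by auto
  \<comment> \<open>The image of \<open>f\<close> is a proper ideal and so lies in
    \<open>\<mm>\<close>; this is what allows its elements to be multiplied by \<open>y / x\<close>
    within \<open>R\<close>.\<close>
  have "ideal (f ` carrier M) R"
    by (rule T.M.hom_to_ring_image_ideal[OF fH])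
  then have fm: "f u \<in> \<mm>" if "u \<in> I" for u
    using proper_ideal_subset[of "f ` I"] proper that by auto

  \<comment> \<open>A functional that is not a multiple of \<open>f\<close>\<close>
  obtain x y where xy: "x \<in> carrier R" "y \<in> carrier R" "x \<noteq> \<zero>" "y \<notin> PIdl x"
    and socle: "\<And>t. t \<in> \<mm> \<Longrightarrow> y \<otimes> t \<in> PIdl x"
    using dim_one_domain_socle[OF assms(1) dim] by auto
  \<comment> \<open>This is \<open>f\<close> multiplied by the fraction \<open>y / x\<close>. The
    value is unique because \<open>x\<close> cancels, and linearity is checked after multiplying by
    \<open>x\<close>.\<close>
  define h where "h u = (SOME z. z \<in> carrier R \<and> y \<otimes> f u = z \<otimes> x)" for u
  have h: "h u \<in> carrier R" "y \<otimes> f u = h u \<otimes> x" if u: "u \<in> I" for u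
  proof -
    have "\<exists>z. z \<in> carrier R \<and> y \<otimes> f u = z \<otimes> x"
      using socle[OF fm[OF u]] unfolding cgenideal_def by auto
    from someI_ex[OF this] show "h u \<in> carrier R" "y \<otimes> f u = h u \<otimes> x"
      unfolding h_def by auto
  qed
  have cancel_x: "s = t" if "s \<in> carrier R" "t \<in> carrier R" "s \<otimes> x = t \<otimes> x" for s t
    using that xy m_rcancel by auto
  have hH: "h \<in> ?H"
  proof (rule module_homsI)
    fix u assume "u \<in> carrier M"
    then show "h u \<in> carrier (ring_module R)" using h(1) by simp
  next
    fix u v assume "u \<in> carrier M" "v \<in> carrier M"
    then have u: "u \<in> I" and v: "v \<in> I" by simp_all
    have "h (u \<oplus> v) \<otimes> x = (h u \<oplus> h v) \<otimes> x"
      using h[OF u] h[OF v] h(2)[OF I.a_closed[OF u v]] H(2)[OF fH u v] fR[OF u] fR[OF v] xy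
      by (simp add: l_distr r_distr)
    then have "h (u \<oplus> v) = h u \<oplus> h v"
      using cancel_x h(1) u v by simp
    then show "h (u \<oplus>\<^bsub>M\<^esub> v) = h u \<oplus>\<^bsub>ring_module R\<^esub> h v" by simp
  next
    fix r u assume "r \<in> carrier R" "u \<in> carrier M"
    then have r: "r \<in> carrier R" and u: "u \<in> I" by simp_all
    have ru: "r \<otimes> u \<in> I" using I.I_l_closed[OF u r] .
    have "h (r \<otimes> u) \<otimes> x = y \<otimes> (r \<otimes> f u)"
      using h(2)[OF ru] H(3)[OF fH r u] by simp
    also have "\<dots> = r \<otimes> (y \<otimes> f u)"
      using xy r fR[OF u] by (simp add: m_lcomm)
    also have "\<dots> = (r \<otimes> h u) \<otimes> x"
      using h[OF u] r xy by (simp add: m_assoc)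
    finally have "h (r \<otimes> u) = r \<otimes> h u"
      using cancel_x h(1) ru u r by simp
    then show "h (r \<odot>\<^bsub>M\<^esub> u) = r \<odot>\<^bsub>ring_module R\<^esub> h u" by simp
  qed
  \<comment> \<open>Evaluation at \<open>a\<close> turns the dual into an ideal of \<open>R\<close>,
    so that \<open>exists_linear_modulo\<close> can be applied to it.\<close>
  define A where "A = (\<lambda>\<phi>. \<phi> a) ` carrier D"
  have "(\<lambda>\<phi>. \<phi> a) \<in> module_homs R D (ring_module R)"
    by (rule module_homsI) (simp_all add: D_simps a H(1)[OF DH])
  then have A: "ideal A R"
    unfolding A_def by (rule T.N.hom_to_ring_image_ideal)
  have HA: "\<phi> a \<in> A" if "\<phi> \<in> ?H" for \<phi>
    unfolding A_def using HD[OF that] a by (intro rev_image_eqI[of "restrict \<phi> I"]) simp_all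
  \<comment> \<open>If \<open>h a = r \<otimes> f a\<close>, then cancelling \<open>f a\<close>
    would make \<open>y\<close> a multiple of \<open>x\<close>.\<close>
  have "h a \<notin> PIdl (f a)"
  proof
    assume "h a \<in> PIdl (f a)"
    then obtain r where r: "r \<in> carrier R" "h a = r \<otimes> f a"
      unfolding cgenideal_def by auto
    have "y \<otimes> f a = (r \<otimes> f a) \<otimes> x"
      using h(2)[OF a(1)] r(2) by simp
    also have "\<dots> = (r \<otimes> x) \<otimes> f a"
      using r(1) xy(1) fR[OF a(1)] by algebra
    finally have "y \<otimes> f a = (r \<otimes> x) \<otimes> f a" .
    then have "y = r \<otimes> x"
      using m_rcancel[OF fa0] xy r fR[OF a(1)] by simp
    then show False
      using xy(4) r unfolding cgenideal_def by auto
  qed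
  then have sub: "PIdl (f a) \<subset> A"
    using cgenideal_minimal[OF A HA[OF fH]] HA[OF hH] by auto
  \<comment> \<open>Preceded by evaluation at \<open>a\<close>, this is a nonzero map from the dual
    to the residue field that kills \<open>f\<close>.\<close>
  obtain \<gamma> where \<gamma>: "linear_modulo R \<mm> A \<gamma>" and \<gamma>f: "\<gamma> (f a) \<in> \<mm>"
    and ex: "\<exists>t\<in>A. \<gamma> t \<notin> \<mm>"
    using exists_linear_modulo[OF A cgenideal_ideal[OF fR[OF a(1)]] sub]
      cgenideal_self[OF fR[OF a(1)]] by auto
  obtain \<phi> where \<phi>: "\<phi> \<in> carrier D" "\<gamma> (\<phi> a) \<notin> \<mm>"
    using ex unfolding A_def by auto
  \<comment> \<open>With the zero ideal as the lower one, the same construction gives a nonzero map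
    from \<open>I\<close> to the residue field.\<close>
  have "{\<zero>} \<subset> I" using I0 I.zero_closed by auto
  then obtain \<beta> i where \<beta>: "linear_modulo R \<mm> I \<beta>" and i: "i \<in> I" "\<beta> i \<notin> \<mm>"
    using exists_linear_modulo[OF I zeroideal] by blast
  have \<phi>H: "\<phi> \<in> ?H" by (rule DH[OF \<phi>(1)])
  \<comment> \<open>The trace property is used here: the value of \<open>\<phi>\<close> at
    \<open>i\<close> is also a value of \<open>f\<close>.\<close>
  obtain z where z: "z \<in> I" "\<phi> i = f z"
    using tr[OF \<phi>H[unfolded M_def]] i(1) by auto
  \<comment> \<open>The representative of \<open>f\<close> in the dual, which has to be undefined
    off \<open>I\<close>.\<close>
  define g where "g = restrict f I"
  have gD: "g \<in> carrier D" unfolding g_def by (rule HD[OF fH])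
  have ga: "g a = f a" using a unfolding g_def by simp

  \<comment> \<open>A bilinear map that detects the torsion element\<close>
  define b where "b = (\<lambda>(u, \<psi>). \<beta> u \<otimes> \<gamma> (\<psi> a))"
  have \<beta>D: "\<And>u. u \<in> I \<Longrightarrow> \<beta> u \<in> carrier R"
    "\<And>u v. u \<in> I \<Longrightarrow> v \<in> I \<Longrightarrow> \<beta> (u \<oplus> v) \<ominus> (\<beta> u \<oplus> \<beta> v) \<in> \<mm>"
    "\<And>r u. r \<in> carrier R \<Longrightarrow> u \<in> I \<Longrightarrow> \<beta> (r \<otimes> u) \<ominus> r \<otimes> \<beta> u \<in> \<mm>"
    using \<beta> unfolding linear_modulo_def by auto
  have \<gamma>D: "\<And>u. u \<in> A \<Longrightarrow> \<gamma> u \<in> carrier R"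
    "\<And>u v. u \<in> A \<Longrightarrow> v \<in> A \<Longrightarrow> \<gamma> (u \<oplus> v) \<ominus> (\<gamma> u \<oplus> \<gamma> v) \<in> \<mm>"
    "\<And>r u. r \<in> carrier R \<Longrightarrow> u \<in> A \<Longrightarrow> \<gamma> (r \<otimes> u) \<ominus> r \<otimes> \<gamma> u \<in> \<mm>"
    using \<gamma> unfolding linear_modulo_def by auto
  \<comment> \<open>Every defect of bilinearity is a defect of \<open>\<beta>\<close> or
    \<open>\<gamma>\<close>, which lies in \<open>\<mm>\<close>, times an element of
    \<open>R\<close>.\<close>
  have b: "bilinear_modulo R \<mm> M D b"
    unfolding bilinear_modulo_def
  proof (intro conjI ballI funcsetI)
    fix p assume "p \<in> carrier M \<times> carrier D"
    then show "b p \<in> carrier R"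
      by (auto simp: b_def \<beta>D(1) \<gamma>D(1) HA DH)
  next
    fix u v \<psi> assume "u \<in> carrier M" "v \<in> carrier M" and \<psi>: "\<psi> \<in> carrier D"
    then have uv: "u \<in> I" "v \<in> I" by simp_all
    have "\<gamma> (\<psi> a) \<in> carrier R" "\<beta> (u \<oplus> v) \<in> carrier R" "\<beta> u \<in> carrier R" "\<beta> v \<in> carrier R"
      using uv \<psi> by (simp_all add: \<beta>D(1) \<gamma>D(1) HA DH)
    then have "b (u \<oplus> v, \<psi>) \<ominus> (b (u, \<psi>) \<oplus> b (v, \<psi>)) = (\<beta> (u \<oplus> v) \<ominus> (\<beta> u \<oplus> \<beta> v)) \<otimes> \<gamma> (\<psi> a)"
      unfolding b_def prod.case by algebra
    also have "\<dots> \<in> \<mm>"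
      by (rule m.I_r_closed[OF \<beta>D(2)[OF uv] \<gamma>D(1)[OF HA[OF DH[OF \<psi>]]]])
    finally show "b (u \<oplus>\<^bsub>M\<^esub> v, \<psi>) \<ominus> (b (u, \<psi>) \<oplus> b (v, \<psi>)) \<in> \<mm>" by simp
  next
    fix u \<psi> \<chi> assume "u \<in> carrier M" and \<psi>: "\<psi> \<in> carrier D" and \<chi>: "\<chi> \<in> carrier D"
    then have u: "u \<in> I" by simp
    note A' = HA[OF DH[OF \<psi>]] HA[OF DH[OF \<chi>]]
    have sumA: "\<psi> a \<oplus> \<chi> a \<in> A" by (rule additive_subgroup.a_closed[OF ideal.axioms(1)[OF A] A'])
    have "b (u, \<psi> \<oplus>\<^bsub>D\<^esub> \<chi>) \<ominus> (b (u, \<psi>) \<oplus> b (u, \<chi>))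
        = \<beta> u \<otimes> (\<gamma> (\<psi> a \<oplus> \<chi> a) \<ominus> (\<gamma> (\<psi> a) \<oplus> \<gamma> (\<chi> a)))"
      unfolding b_def prod.case D_simps(1)[OF a(1)]
      using \<beta>D(1)[OF u] \<gamma>D(1)[OF A'(1)] \<gamma>D(1)[OF A'(2)] \<gamma>D(1)[OF sumA] by algebra
    also have "\<dots> \<in> \<mm>"
      by (rule m.I_l_closed[OF \<gamma>D(2)[OF A'] \<beta>D(1)[OF u]])
    finally show "b (u, \<psi> \<oplus>\<^bsub>D\<^esub> \<chi>) \<ominus> (b (u, \<psi>) \<oplus> b (u, \<chi>)) \<in> \<mm>" .
  next
    fix r u \<psi> assume r: "r \<in> carrier R" and "u \<in> carrier M" and \<psi>: "\<psi> \<in> carrier D"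
    then have u: "u \<in> I" by simp
    have ru: "r \<otimes> u \<in> I" by (rule I.I_l_closed[OF u r])
    note A' = HA[OF DH[OF \<psi>]]
    have rA: "r \<otimes> \<psi> a \<in> A" by (rule ideal.I_l_closed[OF A A' r])
    have "b (r \<otimes> u, \<psi>) \<ominus> r \<otimes> b (u, \<psi>) = (\<beta> (r \<otimes> u) \<ominus> r \<otimes> \<beta> u) \<otimes> \<gamma> (\<psi> a)"
      unfolding b_def prod.case
      using r \<beta>D(1)[OF u] \<beta>D(1)[OF ru] \<gamma>D(1)[OF A'] by algebra
    also have "\<dots> \<in> \<mm>"
      by (rule m.I_r_closed[OF \<beta>D(3)[OF r u] \<gamma>D(1)[OF A']])
    finally show "b (r \<odot>\<^bsub>M\<^esub> u, \<psi>) \<ominus> r \<otimes> b (u, \<psi>) \<in> \<mm>" by simp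
    have "b (u, r \<odot>\<^bsub>D\<^esub> \<psi>) \<ominus> r \<otimes> b (u, \<psi>) = \<beta> u \<otimes> (\<gamma> (r \<otimes> \<psi> a) \<ominus> r \<otimes> \<gamma> (\<psi> a))"
      unfolding b_def prod.case D_simps(2)[OF a(1)]
      using r \<beta>D(1)[OF u] \<gamma>D(1)[OF A'] \<gamma>D(1)[OF rA] by algebra
    also have "\<dots> \<in> \<mm>"
      by (rule m.I_l_closed[OF \<gamma>D(3)[OF r A'] \<beta>D(1)[OF u]])
    finally show "b (u, r \<odot>\<^bsub>D\<^esub> \<psi>) \<ominus> r \<otimes> b (u, \<psi>) \<in> \<mm>" .
  qed
  have bc: "b \<in> carrier M \<times> carrier D \<rightarrow> carrier R"
    using b unfolding bilinear_modulo_def by simp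
  have iM: "i \<in> carrier M" and zM: "z \<in> carrier M" using i z by simp_all
  let ?c = "T.e i \<phi> \<ominus>\<^bsub>T.F\<^esub> T.e z g"
  have e: "T.e i \<phi> \<in> carrier T.F" "T.e z g \<in> carrier T.F"
    by (rule T.generator_closed[OF iM \<phi>(1)], rule T.generator_closed[OF zM gD])
  \<comment> \<open>As \<open>\<gamma> (f a)\<close> is in \<open>\<mm>\<close>, the value at
    \<open>?c\<close> is \<open>\<beta> i \<otimes> \<gamma> (\<phi> a)\<close> up to an element of
    \<open>\<mm>\<close>. Neither factor lies in the prime ideal \<open>\<mm>\<close>.\<close>
  have "?c \<notin> T.K"
  proof
    assume "?c \<in> T.K"
    then have "eval_free b ?c \<in> \<mm>"
      by (rule T.bilinear_modulo_kernel[OF m.ideal_axioms b])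
    moreover have "eval_free b ?c = \<beta> i \<otimes> \<gamma> (\<phi> a) \<ominus> \<beta> z \<otimes> \<gamma> (f a)"
    proof -
      have "eval_free b (T.e i \<phi>) = \<beta> i \<otimes> \<gamma> (\<phi> a)"
        using eval_free_generator[OF SigmaI[OF iM \<phi>(1)] bc] by (simp add: b_def)
      moreover have "eval_free b (T.e z g) = \<beta> z \<otimes> \<gamma> (f a)"
        using eval_free_generator[OF SigmaI[OF zM gD] bc] by (simp add: b_def ga)
      ultimately show ?thesis
        using T.F.hom_to_ring_zero_minus(3)[OF eval_free_hom[OF bc] e] by (simp only:)
    qed
    ultimately have "(\<beta> i \<otimes> \<gamma> (\<phi> a) \<ominus> \<beta> z \<otimes> \<gamma> (f a)) \<oplus> \<beta> z \<otimes> \<gamma> (f a) \<in> \<mm>"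
      using m.I_l_closed[OF \<gamma>f \<beta>D(1)[OF z(1)]] by simp
    then have "\<beta> i \<otimes> \<gamma> (\<phi> a) \<in> \<mm>"
      using \<beta>D(1)[OF i(1)] \<beta>D(1)[OF z(1)] \<gamma>D(1)[OF HA[OF \<phi>H]] \<gamma>D(1)[OF HA[OF fH]]
      by (simp add: a_minus_def a_assoc l_neg)
    then show False
      using primeideal.I_prime[OF maximalideal_prime[OF maximal]
          \<beta>D(1)[OF i(1)] \<gamma>D(1)[OF HA[OF \<phi>H]]] i \<phi> by auto
  qed

  \<comment> \<open>Annihilation by \<open>f a\<close>\<close>
  have \<phi>aR: "\<phi> a \<in> carrier R" by (rule H(1)[OF \<phi>H a(1)])
  \<comment> \<open>After multiplication by the nonzero \<open>a\<close>, applying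
    \<open>swap\<close> once to \<open>\<phi>\<close> and once to \<open>f\<close> identifies the
    two sides.\<close>
  have cross: "f a \<otimes> \<phi> u = \<phi> a \<otimes> f u" if u: "u \<in> I" for u
  proof -
    have \<phi>u: "\<phi> u \<in> carrier R" by (rule H(1)[OF \<phi>H u])
    have "a \<otimes> (f a \<otimes> \<phi> u) = f a \<otimes> (a \<otimes> \<phi> u)"
      using aR fR[OF a(1)] \<phi>u by (simp add: m_lcomm)
    also have "\<dots> = \<phi> a \<otimes> (u \<otimes> f a)"
      unfolding swap[OF \<phi>H a(1) u] using IR[OF u] fR[OF a(1)] \<phi>aR by algebra
    also have "\<dots> = a \<otimes> (\<phi> a \<otimes> f u)"
      unfolding swap[OF fH u a(1)] using aR \<phi>aR fR[OF u] by (simp add: m_lcomm)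
    finally show ?thesis
      using m_lcancel[OF a(2) aR] fR[OF a(1)] fR[OF u] \<phi>u \<phi>aR by simp
  qed
  have smul: "f a \<odot>\<^bsub>D\<^esub> \<phi> = \<phi> a \<odot>\<^bsub>D\<^esub> g"
  proof (rule extensionalityI)
    show "f a \<odot>\<^bsub>D\<^esub> \<phi> \<in> extensional I" "\<phi> a \<odot>\<^bsub>D\<^esub> g \<in> extensional I"
      using \<phi>(1) gD fR[OF a(1)] \<phi>aR by (simp_all add: Dext)
    show "(f a \<odot>\<^bsub>D\<^esub> \<phi>) u = (\<phi> a \<odot>\<^bsub>D\<^esub> g) u" if u: "u \<in> I" for u
      using cross[OF u] u by (simp add: D_simps g_def)
  qed
  \<comment> \<open>By \<open>cross\<close> and the choice of \<open>z\<close>, both sides equal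
    \<open>f a \<otimes> f z\<close>. Injectivity of \<open>f\<close> then compares the
    arguments.\<close>
  have "f (\<phi> a \<otimes> i) = f (f a \<otimes> z)"
    using cross[OF i(1)] z(2) H(3)[OF fH \<phi>aR i(1)] H(3)[OF fH fR[OF a(1)] z(1)] by simp
  then have move: "\<phi> a \<otimes> i = f a \<otimes> z"
    using inj_onD[OF inj] I.I_l_closed[OF i(1) \<phi>aR] I.I_l_closed[OF z(1) fR[OF a(1)]] by simp
  \<comment> \<open>The scalar \<open>f a\<close> moves into the right factor, where
    \<open>smul\<close> exchanges \<open>\<phi>\<close> for \<open>g\<close> and \<open>f a\<close>
    for \<open>\<phi> a\<close>. This new scalar crosses to the left factor, where
    \<open>move\<close> exchanges \<open>i\<close> for \<open>z\<close>.\<close>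
  have "T.K +>\<^bsub>T.F\<^esub> (f a \<odot>\<^bsub>T.F\<^esub> T.e i \<phi>) = T.K +>\<^bsub>T.F\<^esub> T.e i (f a \<odot>\<^bsub>D\<^esub> \<phi>)"
    by (rule T.tensor_coset_smult_right[symmetric, OF fR[OF a(1)] iM \<phi>(1)])
  also have "\<dots> = T.K +>\<^bsub>T.F\<^esub> (\<phi> a \<odot>\<^bsub>T.F\<^esub> T.e i g)"
    unfolding smul by (rule T.tensor_coset_smult_right[OF \<phi>aR iM gD])
  also have "\<dots> = T.K +>\<^bsub>T.F\<^esub> T.e (\<phi> a \<odot>\<^bsub>M\<^esub> i) g"
    by (rule T.tensor_coset_smult_left[symmetric, OF \<phi>aR iM gD])
  also have "\<dots> = T.K +>\<^bsub>T.F\<^esub> T.e (f a \<odot>\<^bsub>M\<^esub> z) g"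
    using move by simp
  also have "\<dots> = T.K +>\<^bsub>T.F\<^esub> (f a \<odot>\<^bsub>T.F\<^esub> T.e z g)"
    by (rule T.tensor_coset_smult_left[OF fR[OF a(1)] zM gD])
  finally have "f a \<odot>\<^bsub>T.F\<^esub> T.e i \<phi> \<ominus>\<^bsub>T.F\<^esub> f a \<odot>\<^bsub>T.F\<^esub> T.e z g \<in> T.K"
    using e fR[OF a(1)] by (simp add: T.F.submodule_coset_eq_iff[OF T.tensor_kernel_submodule] del: M_simps)
  then have "f a \<odot>\<^bsub>T.F\<^esub> ?c \<in> T.K"
    using e fR[OF a(1)] by (simp add: a_minus_def T.F.smult_r_distr T.F.smult_r_minus del: M_simps)
  then have "torsion_submodule R (quotient_module T.F T.K) \<noteq> {\<zero>\<^bsub>quotient_module T.F T.K\<^esub>}"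
    using e \<open>?c \<notin> T.K\<close> fa0 fR[OF a(1)]
    by (intro T.F.torsion_quotient_nontrivial[OF T.tensor_kernel_submodule, of ?c "f a"]) (simp_all del: M_simps)
  then show ?thesis
    unfolding tensor_module_def Let_def D_def M_def .
qed

end

section \<open>From the trace ideal and non-freeness to conditions on an embedding\<close>

theorem proposition6p8:
  fixes R :: "('a, 'r) ring_scheme"
    and N :: "('a, 'n, 'y) module_scheme"
    and I :: "'a set"
  assumes "gorenstein_local_ring R"
    and "domain R"
    and "krull_dimension R = 1"
    and "ideal I R"
    and "I \<noteq> {\<zero>\<^bsub>R\<^esub>}"
    and "module R N"
    and "module_isomorphic R (ideal_module R I) (ideal_module R (trace_ideal R N))"
    and "\<not> is_free_module R (ideal_module R I)"
  shows "torsion_submodule R (tensor_module R (ideal_module R I) (dual_module R (ideal_module R I)))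
    \<noteq> {\<zero>\<^bsub>tensor_module R (ideal_module R I) (dual_module R (ideal_module R I))\<^esub>}"
proof -
  interpret domain R by fact
  have "noetherian_ring R" and "\<exists>!\<mm>. maximalideal \<mm> R"
    using assms(1) unfolding gorenstein_local_ring_def local_ring_def by auto
  then obtain \<mm> where \<mm>: "maximalideal \<mm> R" "\<And>J. maximalideal J R \<Longrightarrow> J = \<mm>"
    by auto
  interpret noetherian_local_ring R \<mm>
    by (rule noetherian_local_ring.intro[OF cring_axioms \<open>noetherian_ring R\<close>])
      (rule noetherian_local_ring_axioms.intro[OF \<mm>])
  interpret I: ideal I R by fact
  let ?J = "trace_ideal R N"
  obtain f where f: "f \<in> module_homs R (ideal_module R I) (ideal_module R ?J)"
    and bij: "bij_betw f I ?J"
    using assms(7) unfolding module_isomorphic_def by auto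
  have inj: "inj_on f I" and img: "f ` I = ?J"
    using bij by (auto simp: bij_betw_def)
  let ?g = "inv_into I f"
  have g: "?g \<in> module_homs R (ideal_module R ?J) (ideal_module R I)"
    using module_homs_inv[OF f _ ideal_module_is_module[OF assms(4)]] bij by simp
  have fR: "f \<in> module_homs R (ideal_module R I) (ring_module R)"
    using module_homsD[OF f] trace_ideal_subset[of N] by (intro module_homsI) auto
  note fD = module_homsD[OF fR, simplified]
  \<comment> \<open>Preceded by the inverse of \<open>f\<close>, the functional
    \<open>\<phi>\<close> becomes a functional on the trace ideal, and such a functional maps the
    trace ideal into itself.\<close>
  have tr: "\<phi> ` I \<subseteq> f ` I" if \<phi>: "\<phi> \<in> module_homs R (ideal_module R I) (ring_module R)" for \<phi>
  proof
    fix t assume "t \<in> \<phi> ` I"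
    then obtain u where u: "u \<in> I" "t = \<phi> u" by auto
    have "\<phi> (?g (f u)) \<in> ?J"
      using u img by (intro trace_ideal_hom_closed[OF assms(6) module_homs_compose[OF g \<phi>]]) auto
    then show "t \<in> f ` I"
      using u inj img by simp
  qed
  \<comment> \<open>If the trace ideal were all of \<open>R\<close>, the preimage of the unit
    element would be a basis of \<open>I\<close>.\<close>
  have proper: "f ` I \<noteq> carrier R"
  proof
    assume "f ` I = carrier R"
    then obtain b where b: "b \<in> I" "f b = \<one>\<^bsub>R\<^esub>"
      using one_closed by (metis imageE)
    \<comment> \<open>Applying \<open>f\<close> recovers the coefficient of a multiple of
      \<open>b\<close>; this gives both spanning and uniqueness.\<close>
    have fb: "f (c \<otimes>\<^bsub>R\<^esub> b) = c" if "c \<in> carrier R" for c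
      using fD(3)[OF that b(1)] b that by simp
    have "is_free_module R (ideal_module R I)"
    proof (rule free_ideal_module_singleton[OF assms(4) b(1)])
      fix i assume i: "i \<in> I"
      then have "f (f i \<otimes>\<^bsub>R\<^esub> b) = f i" using fb fD(1) by simp
      then have "i = f i \<otimes>\<^bsub>R\<^esub> b"
        using inj_onD[OF inj, of "f i \<otimes>\<^bsub>R\<^esub> b" i] i b fD(1)[OF i] by (simp add: I.I_l_closed)
      then show "\<exists>c\<in>carrier R. i = c \<otimes>\<^bsub>R\<^esub> b" using fD(1)[OF i] by (intro bexI[of _ "f i"])
    next
      fix c d assume c: "c \<in> carrier R" and d: "d \<in> carrier R" and eq: "c \<otimes>\<^bsub>R\<^esub> b = d \<otimes>\<^bsub>R\<^esub> b"
      show "c = d"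
        using fb[OF c] fb[OF d] unfolding eq by (rule trans[OF sym])
    qed
    then show False using assms(8) by simp
  qed
  show ?thesis
    by (rule tensor_dual_torsion[OF assms(2-5) fR inj _ proper]) (rule tr)
qed

end
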